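(* Let $\{x^k\}_{k\ge0}$ be an infinite sequence of iterates generated by the Riemannian trust-region method described in the context with $\tilde r\in[0,\frac14)$. Suppose that all steps $p^k$ obtained in the method satisfy the Cauchy decrease inequality $$m_k(0)-m_k(p^k)\ge c_1\|\operatorname{grad}J^B(x^k)\|_{\mathcal E}\,\min\left(\Delta^k,\frac{\|\operatorname{grad}J^B(x^k)\|_{\mathcal E}}{\|\operatorname{Hess}J^B_{x^k}(0)\|}\right)$$ for some constant $c_1>0$. Then $$\liminf_{k\to\infty}\|\operatorname{grad}J^B(x^k)\|_{\mathcal E}=0 .$$
   Context: $\mathcal E,\mathcal Y$ are real Hilbert spaces, $\mathcal Y\neq\{0\}$. $\mathcal M\subset\mathcal E$ is a $C^2$ embedded submanifold; for $x\in\mathcal M$ the tangent space $T_x\mathcal M$ is identified with a closed linear subspace of $\mathcal E$. $B:\mathcal E\to\mathcal Y$ is a surjective bounded linear operator with adjoint $B^*$, $c\in\mathcal Y$, and $\mathcal M^B:=\{x\in\mathcal M: Bx=c\}$ is nonempty. For each $x\in\mathcal M$ a bounded linear projection $P_x:\mathcal E\to T_x\mathcal M$ onto $T_x\mathcal M$ is given (not necessarily orthogonal), and $L_x:=BP_xB^*$. For each $x\in\mathcal M$ a $C^2$ map $R_x:T_x\mathcal M\to\mathcal M$ is given with $R_x(0)=x$, $DR_x(0)=\mathrm{Id}$, and $x\mapsto D^2R_x(0)$ is bounded on bounded subsets of $\mathcal M$. Standing assumptions: (A1) for every bounded $S\subset\mathcal M^B$ there is $C_S>0$ with $(L_x\delta,\delta)_{\mathcal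 Y}\ge C_S\|\delta\|_{\mathcal Y}^2$ for all $x\in S$, $\delta\in\mathcal Y$; (A2) $x\mapsto P_x\in\mathcal L(\mathcal E,\mathcal E)$ is continuous on $\mathcal M$ and maps bounded sets to bounded sets; (A3) for every bounded $S\subset\mathcal M$ there are $\sigma,K_1,K_2>0$ such that $\|DR_x(u)\|\le K_1$ and $\|D^2R_x(u)\|\le K_2$ for all $x\in S$, $u\in T_x\mathcal M$ with $\|u\|_{\mathcal E}\le\sigma$. Under (A1), $L_x$ is invertible and $\mathcal M^B$ is a $C^2$ Hilbert submanifold with $T_x\mathcal M^B=T_x\mathcal M\cap\ker B$ and ambient metric $(u,v)_x=(u,v)_{\mathcal E}$, norm $\|\cdot\|_x$. Objective: $J:\mathcal E\to\mathbb R$ is $C^2$, bounded from below, coercive (bounded sublevel sets), with $\operatorname{grad}J$ and $\operatorname{Hess}J$ mapping bounded sets to bounded sets. $J^B:=J|_{\mathcal M^B}$, with Riemannian gradient $\operatorname{grad}J^B(x)\in T_x\mathcal M^B$ for $(\cdot,\cdot)_x$. Let $x^0\in\mathcal M^B$ be the initial point and $X:=\{x\in\mathcal M^B: J^B(x)\le J^B(x^0)\}$, a bounded set. Constants for $X$: $\|P_x\|\le K_P$, $\|L_x^{-1}\|\le K_L$ on $X$; $\sigma,K_1,K_2$ as in (A3) with $S=X$; $$r:=\min\Bigl\{\tfrac{\sigma}{2K_P\|B\|},\tfrac{1}{4K_2K_LK_P^2\|B\|^3}\Bigr\},\qquad \Delta_s:=\min\Bigl\{\tfrac{\sigma}{2},\tfrac{1}{4K_2K_LK_P\|B\|^2},\tfrac{r}{2K_1K_L\|B\|}\Bigr\}.$$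 For $x\in X$, $v\in T_x\mathcal M^B$ with $\|v\|_x<\Delta_s$, $\delta_x(v)$ is the unique $\delta\in\mathcal Y$ with $\|\delta\|_{\mathcal Y}\le r$ and $BR_x(v-P_xB^*\delta)=c$ ($\delta_x$ is $C^2$, $\delta_x(0)=0$); $R_x^B(v):=R_x(v-P_xB^*\delta_x(v))\in\mathcal M^B$ and $J_x^B(v):=J^B(R_x^B(v))$. $\operatorname{Hess}J_x^B(0)$ is the Hessian of $J_x^B$ at $0$ as an operator on $(T_x\mathcal M^B,(\cdot,\cdot)_x)$, with operator norm $\|\cdot\|$. The constants $0<\Delta_{RL}<\Delta_s$ and $\beta_{RL}>0$ are such that $|\frac{d}{ds}J_x^B(s\xi)|_{s=t}-\frac{d}{ds}J_x^B(s\xi)|_{s=0}|\le\beta_{RL}t$ for all $x\in X$, unit $\xi\in T_x\mathcal M^B$, $t\in[0,\Delta_{RL}]$ (such constants exist). Trust-region method: given $\bar\Delta\in(0,\Delta_{RL}]$, $x^0\in\mathcal M^B$, $\Delta^0\in(0,\bar\Delta]$, $\tilde r\in[0,\frac14)$. For each $k\ge0$: let $$m_k(p):=J^B_{x^k}(0)+\bigl(\operatorname{grad}J^B(x^k),p\bigr)_{x^k}+\tfrac12\bigl(\operatorname{Hess}J^B_{x^k}(0)[p],p\bigr)_{x^k},\quad p\in T_{x^k}\mathcal M^B;$$ obtain $p^k\in T_{x^k}\mathcal M^B$ with $\|p^k\|_{x^k}\le\Delta^k$ (an approximate minimizer of $m_k$ over this ball); set $x_+^k=R^B_{x^k}(p^k)$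 and $$\rho_k:=\frac{J^B(x^k)-J^B(x^k_+)}{m_k(0)-m_k(p^k)} .$$ If $\rho_k<\frac14$, set $\Delta^{k+1}=\frac14\Delta^k$; else if $\rho_k>\frac34$ and $\|p^k\|_{x^k}=\Delta^k$, set $\Delta^{k+1}=\min(2\Delta^k,\bar\Delta)$; else $\Delta^{k+1}=\Delta^k$. If $\rho_k>\tilde r$, set $x^{k+1}=x_+^k$; else $x^{k+1}=x^k$. The method is assumed to run indefinitely, with $\rho_k$ well defined (nonzero denominator) for each $k$. In the Cauchy decrease inequality, the quotient is read as $+\infty$ if $\|\operatorname{Hess}J^B_{x^k}(0)\|=0$. *)

theory Defs
  imports "HOL-Analysis.Analysis"
begin

section \<open>Calculus on subsets and closed subspaces of a Hilbert space\<close>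

text \<open>
  Hilbert spaces are types of sort \<open>{real_inner, banach}\<close>; subspaces are sets. The predicate below is
  used with \<open>S\<close> open or \<open>S\<close> a closed linear subspace. On a subspace \<open>S\<close> a derivative within \<open>S\<close> is
  determined only on \<open>S\<close>, and \<open>f'\<close>, \<open>f''\<close> are witnesses extended to the whole space (precomposing with
  the orthogonal projection onto \<open>S\<close> is always possible). Everything below evaluates them only in
  directions in \<open>S\<close>.
\<close>

definition C2_on ::
  "'a::real_normed_vector set \<Rightarrow> ('a \<Rightarrow> 'b::real_normed_vector) \<Rightarrow> ('a \<Rightarrow> 'a \<Rightarrow>\<^sub>L 'b) \<Rightarrow> ('a \<Rightarrow> 'a \<Rightarrow>\<^sub>L 'a \<Rightarrow>\<^sub>L 'b) \<Rightarrow> bool"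
  where "C2_on S f f' f'' \<longleftrightarrow>
    (\<forall>u\<in>S. (f has_derivative blinfun_apply (f' u)) (at u within S)) \<and>
    (\<forall>u\<in>S. (f' has_derivative blinfun_apply (f'' u)) (at u within S)) \<and>
    continuous_on S f''"

text \<open>Operator norms of linear and bilinear maps restricted to a subspace; the convention \<open>0 / 0 = 0\<close> is
  that of \<^const>\<open>onorm\<close>.\<close>

definition onorm_on :: "'a::real_normed_vector set \<Rightarrow> ('a \<Rightarrow> 'b::real_normed_vector) \<Rightarrow> real"
  where "onorm_on T A = (SUP v\<in>T. norm (A v) / norm v)"

definition onorm2_on :: "'a::real_normed_vector set \<Rightarrow> ('a \<Rightarrow> 'a \<Rightarrow> 'b::real_normed_vector) \<Rightarrow> real"
  where "onorm2_on T A = (SUP v\<in>T. onorm_on T (A v) / norm v)"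

definition grad_on :: "'a::real_inner set \<Rightarrow> ('a \<Rightarrow> real) \<Rightarrow> 'a \<Rightarrow> 'a"
  where "grad_on T f u = (THE g. g \<in> T \<and> (f has_derivative (\<lambda>h. g \<bullet> h)) (at u within T))"

text \<open>The Hessian operator on the Hilbert space \<open>T\<close>, as derivative of the gradient; only its values on \<open>T\<close>
  are meaningful.\<close>

definition hess_on :: "'a::real_inner set \<Rightarrow> ('a \<Rightarrow> real) \<Rightarrow> 'a \<Rightarrow> 'a \<Rightarrow> 'a"
  where "hess_on T f u = frechet_derivative (grad_on T f) (at u within T)"

section \<open>Embedded submanifolds\<close>

text \<open>Local flattening by an ambient \<open>C\<^sup>2\<close> diffeomorphism. Composing with a linear isomorphism,
  the chart may be taken with values in the ambient space itself.\<close>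

definition C2_submanifold :: "'a::{real_inner,banach} set \<Rightarrow> bool"
  where "C2_submanifold M \<longleftrightarrow>
    (\<forall>x\<in>M. \<exists>U V (\<phi> :: 'a \<Rightarrow> 'a) \<phi>' \<phi>'' (\<psi> :: 'a \<Rightarrow> 'a) \<psi>' \<psi>'' F.
        open U \<and> open V \<and> x \<in> U \<and> homeomorphism U V \<phi> \<psi> \<and>
        C2_on U \<phi> \<phi>' \<phi>'' \<and> C2_on V \<psi> \<psi>' \<psi>'' \<and>
        subspace F \<and> closed F \<and> \<phi> ` (U \<inter> M) = V \<inter> F)"

definition C1_curve_at :: "'a::real_normed_vector set \<Rightarrow> 'a \<Rightarrow> 'a \<Rightarrow> (real \<Rightarrow> 'a) \<Rightarrow> bool"
  where "C1_curve_at N x v \<gamma> \<longleftrightarrow>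
    (\<exists>\<epsilon>>0. \<exists>\<gamma>'. (\<forall>t\<in>{-\<epsilon><..<\<epsilon>}. \<gamma> t \<in> N \<and> (\<gamma> has_vector_derivative \<gamma>' t) (at t)) \<and>
        continuous_on {-\<epsilon><..<\<epsilon>} \<gamma>' \<and> \<gamma> 0 = x \<and> \<gamma>' 0 = v)"

definition tangent_space :: "'a::real_normed_vector set \<Rightarrow> 'a \<Rightarrow> 'a set"
  where "tangent_space N x = {v. \<exists>\<gamma>. C1_curve_at N x v \<gamma>}"

text \<open>Riemannian gradient at \<open>x\<close> of \<open>f\<close> restricted to \<open>N\<close>, for the metric induced by the ambient inner product:
  the tangent vector representing the differential of \<open>f\<close> along curves in \<open>N\<close>.\<close>

definition riem_grad :: "'a::real_inner set \<Rightarrow> ('a \<Rightarrow> real) \<Rightarrow> 'a \<Rightarrow> 'a"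
  where "riem_grad N f x =
    (THE g. g \<in> tangent_space N x \<and>
       (\<forall>v \<gamma>. C1_curve_at N x v \<gamma> \<longrightarrow> ((\<lambda>t. f (\<gamma> t)) has_real_derivative (g \<bullet> v)) (at 0)))"

section \<open>The linearly constrained manifold and its corrected retraction\<close>

definition constrained :: "'e::{real_inner,banach} set \<Rightarrow> ('e \<Rightarrow>\<^sub>L 'y::{real_inner,banach}) \<Rightarrow> 'y \<Rightarrow> 'e set"
  where "constrained M B c = {x\<in>M. blinfun_apply B x = c}"

definition schur_op ::
  "('e::{real_inner,banach} \<Rightarrow>\<^sub>L 'y::{real_inner,banach}) \<Rightarrow> ('e \<Rightarrow> 'e \<Rightarrow>\<^sub>L 'e) \<Rightarrow> 'e \<Rightarrow> 'y \<Rightarrow> 'y"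
  where "schur_op B P x d = blinfun_apply B (blinfun_apply (P x) (adjoint (blinfun_apply B) d))"

definition correction ::
  "('e::{real_inner,banach} \<Rightarrow>\<^sub>L 'y::{real_inner,banach}) \<Rightarrow> 'y \<Rightarrow> ('e \<Rightarrow> 'e \<Rightarrow>\<^sub>L 'e) \<Rightarrow> ('e \<Rightarrow> 'e \<Rightarrow> 'e) \<Rightarrow>
     real \<Rightarrow> 'e \<Rightarrow> 'e \<Rightarrow> 'y"
  where "correction B c P R r x v =
    (THE d. norm d \<le> r \<and>
       blinfun_apply B (R x (v - blinfun_apply (P x) (adjoint (blinfun_apply B) d))) = c)"

definition corrected_retraction ::
  "('e::{real_inner,banach} \<Rightarrow>\<^sub>L 'y::{real_inner,banach}) \<Rightarrow> 'y \<Rightarrow> ('e \<Rightarrow> 'e \<Rightarrow>\<^sub>L 'e) \<Rightarrow> ('e \<Rightarrow> 'e \<Rightarrow> 'e) \<Rightarrow>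
     real \<Rightarrow> 'e \<Rightarrow> 'e \<Rightarrow> 'e"
  where "corrected_retraction B c P R r x v =
    R x (v - blinfun_apply (P x) (adjoint (blinfun_apply B) (correction B c P R r x v)))"

end

theory Submission
  imports Defs
begin

text \<open>
  The convergence argument for trust-region methods needs three facts about the iteration, uniform over
  the sublevel set \<open>X\<close>: the iterates stay in \<open>X\<close>, the model agrees with the objective along the step up to
  a quadratic error in the radius, and the model Hessians are bounded. From these, real-number
  arithmetic suffices (\<open>trust_region_liminf\<close>): gradients bounded away from \<open>0\<close> would keep the radii bounded
  away from \<open>0\<close>, and then the objective would decrease without bound.

  The analytic work lies in the corrected retraction. At a point \<open>y\<close> of \<open>X\<close>, the correction solves an equation
  that is a fixed-point problem for a simplified Newton iteration with the inverse of the Schur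
  complement, which exists by coercivity (\<open>coercive_inverse\<close>). The formulas for \<open>r\<close> and \<open>\<Delta>\<^sub>s\<close> make
  this iteration a contraction with factor \<open>1/2\<close> on the ball of radius \<open>r\<close> (\<open>radius_bounds\<close>), so the
  correction exists and is unique. The fixed point of a differentiable contraction depends differentiably on its
  parameter (\<open>fixed_point_has_derivative\<close>); its derivative is the fixed point of an affine contraction on
  operators, so the same theorem also differentiates the derivative.

  Consequently the corrected retraction is a continuously differentiable map into the constrained manifold whose
  derivative at \<open>0\<close> is the identity on the tangent space. This identifies the tangent space of the
  constrained manifold (\<open>tangent_space_constrained\<close>) and its Riemannian gradient as the orthogonal
  projection of the ambient one (\<open>riem_grad_constrained\<close>). It also justifies the mean value theorem
  along rays, where the radial Lipschitz bound controls the linearization error of the pullback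
  (\<open>pullback_linearization_error\<close>).

  The Hessian bound comes from the explicit second derivative of the corrected retraction at \<open>0\<close>: it is
  the second derivative of the given retraction, projected along the correction directions. Together
  with the boundedness of gradient and Hessian of the objective on \<open>X\<close> this bounds the operator norm of
  the pullback Hessian (\<open>pullback_hessian_bound\<close>), which enters both the quadratic model error and the
  quotient in the Cauchy decrease.
\<close>

section \<open>Projection and duality in Hilbert spaces\<close>

text \<open>
  A minimizing sequence for the distance from \<open>v\<close> to \<open>W\<close> is Cauchy by the parallelogram law, because the
  midpoint of two of its members is again in \<open>W\<close> and hence at least as far from \<open>v\<close> as the infimum. Its
  limit satisfies the variational equation, and that equation determines the projection uniquely on \<open>W\<close>,
  so the choice of the limit point is linear in \<open>v\<close>.
\<close>

lemma closed_subspace_has_projection: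
  fixes W :: "'a::{real_inner,banach} set"
  assumes W: "subspace W" "closed W"
  obtains Q :: "'a \<Rightarrow>\<^sub>L 'a"
  where "\<And>v. Q v \<in> W" "\<And>w. w \<in> W \<Longrightarrow> Q w = w" "\<And>v w. w \<in> W \<Longrightarrow> Q v \<bullet> w = v \<bullet> w"
    "\<And>v. norm (Q v) \<le> norm v"
proof -
  have ex: "\<exists>q\<in>W. \<forall>w\<in>W. q \<bullet> w = v \<bullet> w" for v
  proof -
    define d where "d = (INF w\<in>W. (norm (v - w))\<^sup>2)"
    have W0: "0 \<in> W" using W(1) by (rule subspace_0)
    have bdd: "bdd_below ((\<lambda>w. (norm (v - w))\<^sup>2) ` W)" by (intro bdd_belowI2[of _ 0]) auto
    have dle: "d \<le> (norm (v - w))\<^sup>2" if "w \<in> W" for w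
      unfolding d_def by (rule cINF_lower[OF bdd that])
    have "\<exists>w\<in>W. (norm (v - w))\<^sup>2 < d + inverse (real (Suc n))" for n
      using cINF_less_iff[of W "\<lambda>w. (norm (v - w))\<^sup>2" "d + inverse (real (Suc n))"] W0 bdd
      unfolding d_def[symmetric] by auto
    then obtain w where w: "\<And>n. w n \<in> W" "\<And>n. (norm (v - w n))\<^sup>2 < d + inverse (real (Suc n))"
      by metis
    have gap: "(norm (a - b))\<^sup>2 \<le> 2 * (e1 + e2)"
      if "a \<in> W" "b \<in> W" "(norm (v - a))\<^sup>2 \<le> d + e1" "(norm (v - b))\<^sup>2 \<le> d + e2" for a b e1 e2
    proof -
      have "(1/2) *\<^sub>R (a + b) \<in> W" using W(1) that by (simp add: subspace_add subspace_scale)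
      from dle[OF this] have 1: "d \<le> (norm (v - (1/2) *\<^sub>R (a + b)))\<^sup>2" .
      have "(norm (a - b))\<^sup>2 + 4 * (norm (v - (1/2) *\<^sub>R (a + b)))\<^sup>2
          = 2 * (norm (v - a))\<^sup>2 + 2 * (norm (v - b))\<^sup>2"
        unfolding power2_norm_eq_inner by (simp add: algebra_simps inner_commute)
      with 1 that(3,4) show ?thesis by simp
    qed
    have "Cauchy w"
    proof (rule metric_CauchyI)
      fix e :: real assume "e > 0"
      then obtain N where N: "inverse (real (Suc N)) < e\<^sup>2 / 4"
        using reals_Archimedean[of "e\<^sup>2 / 4"] by auto
      have "dist (w m) (w n) < e" if "m \<ge> N" "n \<ge> N" for m n
      proof -
        have "2 * (inverse (real (Suc m)) + inverse (real (Suc n)))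
            \<le> 2 * (inverse (real (Suc N)) + inverse (real (Suc N)))"
          using that by (intro mult_left_mono add_mono le_imp_inverse_le) auto
        also have "\<dots> < e\<^sup>2" using N by (simp del: of_nat_Suc)
        finally have "2 * (inverse (real (Suc m)) + inverse (real (Suc n))) < e\<^sup>2" .
        with gap[OF w(1) w(1) less_imp_le[OF w(2)] less_imp_le[OF w(2)], of m n]
        have "(norm (w m - w n))\<^sup>2 < e\<^sup>2" by (rule le_less_trans)
        then show ?thesis using \<open>e > 0\<close> unfolding dist_norm
          by (meson less_imp_le power_less_imp_less_base)
      qed
      then show "\<exists>M. \<forall>m\<ge>M. \<forall>n\<ge>M. dist (w m) (w n) < e" by blast
    qed
    then obtain q where q: "w \<longlonglongrightarrow> q" using Cauchy_convergent convergent_def by blast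
    have qW: "q \<in> W" using closed_sequentially[OF W(2) w(1) q] .
    have "(\<lambda>n. d + inverse (real (Suc n))) \<longlonglongrightarrow> d + 0"
      by (intro tendsto_intros LIMSEQ_inverse_real_of_nat)
    moreover have "(\<lambda>n. (norm (v - w n))\<^sup>2) \<longlonglongrightarrow> (norm (v - q))\<^sup>2"
      by (intro tendsto_intros q)
    ultimately have qd: "(norm (v - q))\<^sup>2 \<le> d"
      using w(2) by (intro LIMSEQ_le[of _ _ _ d]) (auto intro!: exI[of _ 0] less_imp_le)
    have "q \<bullet> z = v \<bullet> z" if z: "z \<in> W" for z
    proof (cases "z = 0")
      case False
      \<comment> \<open>the step along \<open>z\<close> that decreases the distance to \<open>v\<close> most\<close>
      define s where "s = ((v - q) \<bullet> z) / (z \<bullet> z)"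
      have zz: "z \<bullet> z > 0" using False by simp
      have "q + s *\<^sub>R z \<in> W" using W(1) qW z by (simp add: subspace_add subspace_scale)
      from dle[OF this] qd have "(norm (v - q))\<^sup>2 \<le> (norm (v - (q + s *\<^sub>R z)))\<^sup>2" by linarith
      also have "\<dots> = (norm (v - q))\<^sup>2 - 2 * s * ((v - q) \<bullet> z) + s\<^sup>2 * (z \<bullet> z)"
        unfolding power2_norm_eq_inner by (simp add: algebra_simps inner_commute power2_eq_square)
      also have "\<dots> = (norm (v - q))\<^sup>2 - ((v - q) \<bullet> z)\<^sup>2 / (z \<bullet> z)"
        using zz unfolding s_def by (simp add: field_simps power2_eq_square)
      finally have "((v - q) \<bullet> z)\<^sup>2 / (z \<bullet> z) \<le> 0" by simp
      then have "((v - q) \<bullet> z)\<^sup>2 \<le> 0" using zz unfolding divide_le_0_iff by linarith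
      then show ?thesis by (simp add: inner_diff_left)
    qed simp
    with qW show ?thesis by blast
  qed
  then obtain Q where Q: "\<And>v. Q v \<in> W" "\<And>v w. w \<in> W \<Longrightarrow> Q v \<bullet> w = v \<bullet> w" by metis
  have uniq: "a = b" if "a \<in> W" "b \<in> W" "\<And>w. w \<in> W \<Longrightarrow> a \<bullet> w = b \<bullet> w" for a b
  proof -
    have "(a - b) \<bullet> (a - b) = 0"
      using that(3)[of "a - b"] W(1) that(1,2) by (simp add: subspace_diff inner_diff_left)
    then show ?thesis by simp
  qed
  have nrm: "norm (Q v) \<le> norm v" for v
  proof -
    have "norm (Q v) * norm (Q v) = v \<bullet> Q v" using Q(2)[OF Q(1), of v v] by (simp add: dot_square_norm power2_eq_square)
    also have "\<dots> \<le> norm v * norm (Q v)" by (rule norm_cauchy_schwarz)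
    finally show ?thesis by (metis mult_right_le_imp_le norm_ge_zero norm_zero order_le_less)
  qed
  have bl: "bounded_linear Q"
  proof (rule bounded_linear_intro[where K = 1])
    show "Q (a + b) = Q a + Q b" for a b
      by (rule uniq) (use W(1) Q in \<open>auto simp: subspace_add inner_add_left\<close>)
    show "Q (s *\<^sub>R a) = s *\<^sub>R Q a" for s a
      by (rule uniq) (use W(1) Q in \<open>auto simp: subspace_scale\<close>)
  qed (use nrm in simp)
  have "Q w = w" if "w \<in> W" for w by (rule uniq) (use Q that in auto)
  with Q nrm show ?thesis using that[of "Blinfun Q"] by (simp add: bounded_linear_Blinfun_apply[OF bl])
qed

lemma riesz_representation:
  fixes f :: "'a::{real_inner,banach} \<Rightarrow>\<^sub>L real"
  obtains g where "\<And>h. f h = g \<bullet> h"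
proof (cases "\<forall>h. f h = 0")
  case True
  then show ?thesis using that[of 0] by simp
next
  case False
  then obtain a where a: "f a \<noteq> 0" by blast
  have sub: "subspace {h. f h = 0}" by (auto simp: subspace_def blinfun.bilinear_simps)
  have clo: "closed {h. f h = 0}" by (intro closed_Collect_eq continuous_intros)
  obtain Q :: "'a \<Rightarrow>\<^sub>L 'a" where Q: "\<And>v. Q v \<in> {h. f h = 0}" "\<And>v w. w \<in> {h. f h = 0} \<Longrightarrow> Q v \<bullet> w = v \<bullet> w"
    using closed_subspace_has_projection[OF sub clo] by metis
  \<comment> \<open>a normal vector of the kernel\<close>
  define n where "n = a - Q a"
  have fn: "f n = f a" using Q(1)[of a] by (simp add: n_def blinfun.bilinear_simps)
  with a have nn: "n \<bullet> n > 0" by (auto simp: blinfun.zero_right)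
  have "f h = ((f a / (n \<bullet> n)) *\<^sub>R n) \<bullet> h" for h
  proof -
    have "f (h - (f h / f a) *\<^sub>R n) = 0" using a fn by (simp add: blinfun.bilinear_simps)
    with Q(2)[of "h - (f h / f a) *\<^sub>R n" a] have "n \<bullet> (h - (f h / f a) *\<^sub>R n) = 0"
      by (simp add: n_def inner_diff_left)
    then have "n \<bullet> h = f h / f a * (n \<bullet> n)" by (simp add: inner_diff_right)
    then show ?thesis using a nn by (simp add: field_simps)
  qed
  then show ?thesis by (rule that)
qed

text \<open>Gradients are obtained by applying this map to differentials, so that a differentiable field of
  differentials yields a differentiable gradient field.\<close>

lemma riesz_isomorphism:
  obtains G :: "('a::{real_inner,banach} \<Rightarrow>\<^sub>L real) \<Rightarrow>\<^sub>L 'a" where "\<And>f h. G f \<bullet> h = f h"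
proof -
  have "\<forall>f :: 'a \<Rightarrow>\<^sub>L real. \<exists>g. \<forall>h. g \<bullet> h = f h" by (metis riesz_representation)
  from choice[OF this] obtain G :: "('a \<Rightarrow>\<^sub>L real) \<Rightarrow> 'a" where G: "\<And>f h. G f \<bullet> h = f h" by blast
  have "bounded_linear G"
  proof (rule bounded_linear_intro[where K = 1])
    show "G (a + b) = G a + G b" for a b
      by (rule vector_eq_rdot[THEN iffD1]) (simp add: G inner_add_left blinfun.add_left)
    show "G (s *\<^sub>R a) = s *\<^sub>R G a" for s a
      by (rule vector_eq_rdot[THEN iffD1]) (simp add: G blinfun.scaleR_left)
    show "norm (G f) \<le> norm f * 1" for f
    proof -
      have "norm (G f) * norm (G f) = f (G f)"
        using G[of f "G f"] by (simp add: dot_square_norm power2_eq_square)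
      also have "\<dots> \<le> norm f * norm (G f)" using norm_blinfun[of f "G f"] by simp
      finally show ?thesis by (metis mult.right_neutral mult_right_le_imp_le norm_ge_zero norm_zero order_le_less)
    qed
  qed
  then show ?thesis using that[of "Blinfun G"] G by (simp add: bounded_linear_Blinfun_apply)
qed

text \<open>The adjoint is chosen by description; the Riesz representation supplies the operator that it picks.\<close>

lemma hilbert_adjoint:
  fixes B :: "'a::{real_inner,banach} \<Rightarrow>\<^sub>L 'b::real_inner"
  shows "B v \<bullet> d = v \<bullet> adjoint B d" "bounded_linear (adjoint B)" "norm (adjoint B d) \<le> norm B * norm d"
proof -
  have "\<exists>g. \<forall>v. B v \<bullet> d = v \<bullet> g" for d
    using riesz_representation[of "blinfun_inner_left d o\<^sub>L B"] by (auto simp: inner_commute)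
  then obtain A where "\<And>v d. B v \<bullet> d = v \<bullet> A d" by metis
  then have adj: "B v \<bullet> d = v \<bullet> adjoint B d" for v d
    using adjoint_unique[of B A] by simp
  then show "B v \<bullet> d = v \<bullet> adjoint B d" .
  have nrm: "norm (adjoint B d) \<le> norm B * norm d" for d
  proof -
    have "norm (adjoint B d) * norm (adjoint B d) = B (adjoint B d) \<bullet> d"
      using adj[of "adjoint B d" d] by (simp add: dot_square_norm power2_eq_square)
    also have "\<dots> \<le> norm (B (adjoint B d)) * norm d" by (rule norm_cauchy_schwarz)
    also have "\<dots> \<le> norm B * norm d * norm (adjoint B d)"
      using mult_right_mono[OF norm_blinfun[of B "adjoint B d"] norm_ge_zero[of d]] by (simp add: mult_ac)
    finally show ?thesis
      by (metis mult_right_le_imp_le norm_ge_zero norm_zero order_le_less mult_nonneg_nonneg)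
  qed
  then show "norm (adjoint B d) \<le> norm B * norm d" .
  show "bounded_linear (adjoint B)"
  proof (rule bounded_linear_intro)
    show "adjoint B (a + b) = adjoint B a + adjoint B b" for a b
      by (rule vector_eq_ldot[THEN iffD1]) (simp add: adj[symmetric] inner_add_right)
    show "adjoint B (s *\<^sub>R a) = s *\<^sub>R adjoint B a" for s a
      by (rule vector_eq_ldot[THEN iffD1]) (simp add: adj[symmetric])
    show "norm (adjoint B d) \<le> norm d * norm B" for d using nrm[of d] by (simp add: mult.commute)
  qed
qed

section \<open>Operators close to the identity and coercive operators\<close>

text \<open>\<open>N z\<close> is the fixed point of the contraction \<open>k \<mapsto> z + A k\<close>; it is linear in \<open>z\<close> by uniqueness.\<close>

lemma neumann_inverse:
  fixes A :: "'b::banach \<Rightarrow>\<^sub>L 'b"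
  assumes "\<And>k. norm (A k) \<le> q * norm k" "0 \<le> q" "q < 1"
  obtains N :: "'b \<Rightarrow>\<^sub>L 'b" where "\<And>z. N z = z + A (N z)" "\<And>k. N (k - A k) = k"
proof -
  have fix1: "\<exists>!k. z + A k = k" for z
    by (rule banach_fix_type[OF assms(2,3)])
      (use assms(1) in \<open>auto simp: dist_norm blinfun.diff_right[symmetric]\<close>)
  then obtain N where N: "\<And>z. z + A (N z) = N z" by metis
  have uniq: "N z = k" if "z + A k = k" for z k using fix1[of z] N[of z] that by blast
  have "bounded_linear N"
  proof (rule bounded_linear_intro[where K = "1 / (1 - q)"])
    show "N (a + b) = N a + N b" for a b
      using arg_cong2[OF N[of a] N[of b], of "(+)"] by (intro uniq) (simp add: blinfun.add_right algebra_simps)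
    show "N (s *\<^sub>R a) = s *\<^sub>R N a" for s a
      using N[of a] by (intro uniq) (metis blinfun.scaleR_right scaleR_right_distrib)
    show "norm (N z) \<le> norm z * (1 / (1 - q))" for z
    proof -
      have "norm (N z) \<le> norm z + q * norm (N z)"
        using N[of z] norm_triangle_ineq[of z "A (N z)"] assms(1)[of "N z"] by simp
      then show ?thesis using assms(3) by (simp add: field_simps)
    qed
  qed
  moreover have "N (k - A k) = k" for k by (rule uniq) simp
  ultimately show ?thesis using that[of "Blinfun N"] N
    by (simp add: bounded_linear_Blinfun_apply)
qed

text \<open>Coercivity and boundedness make \<open>id - s L\<close> a strict contraction for a suitable step \<open>s > 0\<close>, so that
  \<open>s L\<close> is a Neumann perturbation of the identity.\<close>

lemma coercive_inverse:
  fixes L :: "'b::{real_inner,banach} \<Rightarrow>\<^sub>L 'b"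
  assumes C: "C > 0" "\<And>d. L d \<bullet> d \<ge> C * (norm d)\<^sup>2"
  shows "bij L" "bounded_linear (inv L)"
proof -
  \<comment> \<open>adding \<open>C\<close> keeps \<open>M\<close> positive and at least \<open>C\<close>, also on the zero space\<close>
  define M where "M = norm L + C"
  have M: "M > 0" "norm L \<le> M" "C \<le> M" using C by (auto simp: M_def add_nonneg_pos)
  \<comment> \<open>minimizes the bound \<open>1 - 2 s C + s\<^sup>2 M\<^sup>2\<close> for the squared contraction factor\<close>
  define s where "s = C / M\<^sup>2"
  define q where "q = sqrt (1 - C\<^sup>2 / M\<^sup>2)"
  have s: "s > 0" using C M by (simp add: s_def)
  have CM: "C\<^sup>2 / M\<^sup>2 \<le> 1" "C\<^sup>2 / M\<^sup>2 > 0" using C(1) M by (auto simp: power_mono)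
  have q: "0 \<le> q" "q < 1" using CM by (auto simp: q_def)
  have contr: "norm ((id_blinfun - s *\<^sub>R L) k) \<le> q * norm k" for k
  proof (rule power2_le_imp_le)
    have "(norm (L k))\<^sup>2 \<le> (M * norm k)\<^sup>2"
      using norm_blinfun[of L k] M mult_right_mono[OF M(2), of "norm k"] by (intro power_mono) auto
    then have 1: "s\<^sup>2 * (norm (L k))\<^sup>2 \<le> s\<^sup>2 * (M\<^sup>2 * (norm k)\<^sup>2)"
      by (intro mult_left_mono) (auto simp: power_mult_distrib)
    have 2: "2 * s * (L k \<bullet> k) \<ge> 2 * s * (C * (norm k)\<^sup>2)" using s C(2)[of k] by simp
    have "(norm ((id_blinfun - s *\<^sub>R L) k))\<^sup>2 = (norm k)\<^sup>2 - 2 * s * (L k \<bullet> k) + s\<^sup>2 * (norm (L k))\<^sup>2"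
      unfolding power2_norm_eq_inner
      by (simp add: blinfun.bilinear_simps algebra_simps inner_commute power2_eq_square)
    also have "\<dots> \<le> (norm k)\<^sup>2 - 2 * s * (C * (norm k)\<^sup>2) + s\<^sup>2 * (M\<^sup>2 * (norm k)\<^sup>2)" using 1 2 by linarith
    also have "\<dots> = (1 - C\<^sup>2 / M\<^sup>2) * (norm k)\<^sup>2"
      using M(1) by (simp add: s_def field_simps power2_eq_square)
    also have "\<dots> = (q * norm k)\<^sup>2" using CM(1) by (simp add: q_def power_mult_distrib)
    finally show "(norm ((id_blinfun - s *\<^sub>R L) k))\<^sup>2 \<le> (q * norm k)\<^sup>2" .
  qed (use q in auto)
  obtain N :: "'b \<Rightarrow>\<^sub>L 'b" where
    N: "\<And>z. N z = z + (id_blinfun - s *\<^sub>R L) (N z)" "\<And>k. N (k - (id_blinfun - s *\<^sub>R L) k) = k"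
    using neumann_inverse[OF contr q] by metis
  have 1: "s *\<^sub>R N (L k) = k" for k using N(2)[of k] by (simp add: blinfun.bilinear_simps)
  have 2: "L (s *\<^sub>R N z) = z" for z using N(1)[of z] by (simp add: blinfun.bilinear_simps)
  show "bij L" by (rule o_bij[of "\<lambda>z. s *\<^sub>R N z"]) (auto simp: fun_eq_iff 1 2)
  have "inv L = (\<lambda>z. s *\<^sub>R N z)" by (rule inv_equality) (simp_all add: 1 2)
  then show "bounded_linear (inv L)" by (auto intro!: bounded_linear_intros)
qed

section \<open>Differentiability of parametrized fixed points\<close>

text \<open>
  The uniform contraction principle, in the form of an implicit function theorem. Contraction in the
  second argument bounds \<open>\<delta> v - \<delta> v0\<close> by a multiple of the increment of \<open>\<Phi>\<close> in its first argument, so \<open>\<delta>\<close> is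
  Lipschitz at \<open>v0\<close>. Linearizing the fixed-point equation there shows that \<open>\<delta> v - \<delta> v0\<close> solves the
  linearized equation up to \<open>o (norm (v - v0))\<close>, and inverting \<open>id - \<partial>\<^sub>2 \<Phi>\<close> turns this into differentiability.
  Since the derivative is again the fixed point of a contraction, on a space of operators, a second
  application gives the second derivative.
\<close>

lemma fixed_point_has_derivative:
  fixes \<Phi> :: "'a::real_normed_vector \<times> 'b::banach \<Rightarrow> 'b"
  assumes fp: "eventually (\<lambda>v. \<delta> v = \<Phi> (v, \<delta> v)) (nhds v0)"
    and contr: "eventually (\<lambda>v. norm (\<Phi> (v, \<delta> v) - \<Phi> (v, \<delta> v0)) \<le> q * norm (\<delta> v - \<delta> v0)) (nhds v0)"
    and q: "0 \<le> q" "q < 1"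
    and deriv: "(\<Phi> has_derivative \<Phi>') (at (v0, \<delta> v0))"
    and partial: "\<And>k. norm (\<Phi>' (0, k)) \<le> q * norm k"
  obtains D :: "'a \<Rightarrow>\<^sub>L 'b" where "(\<delta> has_derivative D) (at v0)" "\<And>h. D h = \<Phi>' (h, D h)"
proof -
  have bl: "bounded_linear \<Phi>'" using deriv by (rule has_derivative_bounded_linear)
  have lin: "linear \<Phi>'" using bl by (rule bounded_linear.linear)
  have split: "\<Phi>' (h, k) = \<Phi>' (h, 0) + \<Phi>' (0, k)" for h k
    using linear_add[OF lin, of "(h, 0)" "(0, k)"] by simp
  have blA: "bounded_linear (\<lambda>k. \<Phi>' (0, k))" and blB: "bounded_linear (\<lambda>h. \<Phi>' (h, 0))"
    by (auto intro!: bounded_linear_compose[OF bl] bounded_linear_intros)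
  define A where "A = Blinfun (\<lambda>k. \<Phi>' (0, k))"
  have A: "A k = \<Phi>' (0, k)" for k by (simp add: A_def bounded_linear_Blinfun_apply[OF blA])
  obtain N :: "'b \<Rightarrow>\<^sub>L 'b" where N: "\<And>z. N z = z + A (N z)"
    using neumann_inverse[of A q] partial q by (metis A)
  define D where "D = N o\<^sub>L Blinfun (\<lambda>h. \<Phi>' (h, 0))"
  have Dfix: "D h = \<Phi>' (h, D h)" for h
    using N[of "\<Phi>' (h, 0)"] by (simp add: D_def bounded_linear_Blinfun_apply[OF blB] A split[symmetric])
  have fp0: "\<delta> v0 = \<Phi> (v0, \<delta> v0)" using eventually_nhds_x_imp_x[OF fp] .
  have d: "\<exists>s>0. \<forall>v d. norm (v - v0, d - \<delta> v0) < s \<longrightarrow>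
      norm (\<Phi> (v, d) - \<Phi> (v0, \<delta> v0) - \<Phi>' (v - v0, d - \<delta> v0)) \<le> e * norm (v - v0, d - \<delta> v0)"
    if "e > 0" for e
    using deriv[unfolded has_derivative_at_alt, THEN conjunct2, rule_format, OF that] by force
  obtain K where K: "K > 0" "\<And>z. norm (\<Phi>' z) \<le> norm z * K" using bounded_linear.pos_bounded[OF bl] by blast
  define C where "C = (K + 1) / (1 - q)"
  have C0: "C > 0" using K q by (simp add: C_def)
  obtain s1 where s1: "s1 > 0" "\<And>v d. norm (v - v0, d - \<delta> v0) < s1 \<Longrightarrow>
      norm (\<Phi> (v, d) - \<Phi> (v0, \<delta> v0) - \<Phi>' (v - v0, d - \<delta> v0)) \<le> 1 * norm (v - v0, d - \<delta> v0)"
    using d[of 1] by auto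
  obtain s0 where s0: "s0 > 0"
    "\<And>v. norm (v - v0) < s0 \<Longrightarrow> \<delta> v = \<Phi> (v, \<delta> v)"
    "\<And>v. norm (v - v0) < s0 \<Longrightarrow> norm (\<Phi> (v, \<delta> v) - \<Phi> (v, \<delta> v0)) \<le> q * norm (\<delta> v - \<delta> v0)"
    using eventually_conj[OF fp contr] unfolding eventually_nhds_metric dist_norm by blast
  have Lip: "norm (\<delta> v - \<delta> v0) \<le> C * norm (v - v0)" if v: "norm (v - v0) < min s0 s1" for v
  proof -
    have "norm (\<Phi> (v, \<delta> v0) - \<Phi> (v0, \<delta> v0) - \<Phi>' (v - v0, 0)) \<le> norm (v - v0)"
      using s1(2)[of v "\<delta> v0"] v by (simp add: norm_Pair)
    moreover have "norm (\<Phi>' (v - v0, 0)) \<le> norm (v - v0) * K" using K(2)[of "(v - v0, 0)"] by (simp add: norm_Pair)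
    ultimately have "norm (\<Phi> (v, \<delta> v0) - \<Phi> (v0, \<delta> v0)) \<le> (K + 1) * norm (v - v0)"
      using norm_triangle_sub[of "\<Phi> (v, \<delta> v0) - \<Phi> (v0, \<delta> v0)" "\<Phi>' (v - v0, 0)"] by (simp add: algebra_simps)
    moreover have "\<delta> v - \<delta> v0 = (\<Phi> (v, \<delta> v) - \<Phi> (v, \<delta> v0)) + (\<Phi> (v, \<delta> v0) - \<Phi> (v0, \<delta> v0))"
      using s0(2)[of v] v fp0 by simp
    moreover have "norm (\<Phi> (v, \<delta> v) - \<Phi> (v, \<delta> v0)) \<le> q * norm (\<delta> v - \<delta> v0)" using s0(3) v by simp
    ultimately have "norm (\<delta> v - \<delta> v0) \<le> q * norm (\<delta> v - \<delta> v0) + (K + 1) * norm (v - v0)"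
      by (smt (verit) norm_triangle_ineq)
    then have "(1 - q) * norm (\<delta> v - \<delta> v0) \<le> (K + 1) * norm (v - v0)" by (simp add: algebra_simps)
    then show ?thesis using q by (simp add: C_def field_simps)
  qed
  have "(\<delta> has_derivative D) (at v0)"
    unfolding has_derivative_at_alt
  proof (intro conjI allI impI)
    fix e :: real assume e: "e > 0"
    \<comment> \<open>\<open>1 + C\<close> bounds the joint increment by that of \<open>v\<close>, and \<open>1 / (1 - q)\<close> the inverse of \<open>id - \<partial>\<^sub>2 \<Phi>\<close>\<close>
    define e' where "e' = e * (1 - q) / (1 + C)"
    have e': "e' > 0" using e q C0 by (simp add: e'_def)
    obtain s2 where s2: "s2 > 0" "\<And>v d. norm (v - v0, d - \<delta> v0) < s2 \<Longrightarrow>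
      norm (\<Phi> (v, d) - \<Phi> (v0, \<delta> v0) - \<Phi>' (v - v0, d - \<delta> v0)) \<le> e' * norm (v - v0, d - \<delta> v0)"
      using d[OF e'] by auto
    show "\<exists>s>0. \<forall>v. norm (v - v0) < s \<longrightarrow> norm (\<delta> v - \<delta> v0 - D (v - v0)) \<le> e * norm (v - v0)"
    proof (intro exI[of _ "min (min s0 s1) (s2 / (1 + C))"] conjI allI impI)
      show "min (min s0 s1) (s2 / (1 + C)) > 0" using s0(1) s1(1) s2(1) C0 by simp
    next
      fix v assume v: "norm (v - v0) < min (min s0 s1) (s2 / (1 + C))"
      let ?h = "v - v0" and ?k = "\<delta> v - \<delta> v0"
      have "norm (?h, ?k) \<le> norm ?h + norm ?k" by (simp add: norm_Pair sqrt_sum_squares_le_sum)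
      also have "\<dots> \<le> (1 + C) * norm ?h" using Lip[of v] v by (simp add: algebra_simps)
      finally have hk: "norm (?h, ?k) \<le> (1 + C) * norm ?h" .
      also have "\<dots> < s2" using v C0 by (simp add: field_simps)
      finally have "norm (\<Phi> (v, \<delta> v) - \<Phi> (v0, \<delta> v0) - \<Phi>' (?h, ?k)) \<le> e' * norm (?h, ?k)" by (rule s2(2))
      also have "\<dots> \<le> e' * ((1 + C) * norm ?h)" using hk e' by simp
      also have "\<dots> = e * (1 - q) * norm ?h" using C0 by (simp add: e'_def)
      finally have 1: "norm (?k - \<Phi>' (?h, ?k)) \<le> e * (1 - q) * norm ?h" using s0(2)[of v] v fp0 by simp
      have "\<Phi>' (0, ?k - D ?h) = \<Phi>' (0, ?k) - \<Phi>' (0, D ?h)"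
        using linear_diff[OF lin, of "(0, ?k)" "(0, D ?h)"] by simp
      moreover have "\<Phi>' (?h, 0) = D ?h - \<Phi>' (0, D ?h)"
        using Dfix[of ?h] split[of ?h "D ?h"] by (metis add_diff_cancel_right')
      moreover have "(k - d) - c = k - (b + a)" if "c = a - a'" "b = d - a'" for k d c a a' b :: 'b
        using that by simp
      ultimately have eq: "(?k - D ?h) - \<Phi>' (0, ?k - D ?h) = ?k - \<Phi>' (?h, ?k)"
        unfolding split[of ?h ?k] by blast
      have "norm (?k - D ?h) \<le> norm (?k - \<Phi>' (?h, ?k)) + q * norm (?k - D ?h)"
        using partial[of "?k - D ?h"] norm_triangle_sub[of "?k - D ?h" "\<Phi>' (0, ?k - D ?h)"] unfolding eq by linarith
      with 1 have "(1 - q) * norm (?k - D ?h) \<le> (1 - q) * (e * norm ?h)" by (simp add: algebra_simps)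
      then show "norm (\<delta> v - \<delta> v0 - D (v - v0)) \<le> e * norm (v - v0)" using q by simp
    qed
  qed (rule blinfun.bounded_linear_right)
  then show ?thesis using Dfix by (rule that)
qed

section \<open>Convergence of trust-region iterations\<close>

text \<open>
  The part of the convergence proof that concerns only real sequences: \<open>f k\<close> and \<open>fp k\<close> are the objective at
  the iterate and at the trial point, \<open>pred k\<close> the decrease that the model predicts, \<open>g k\<close> and \<open>h k\<close> the norms of
  gradient and model Hessian, and \<open>full k\<close> tells whether the step reaches the boundary.

  If the gradients stay above some \<open>\<epsilon> > 0\<close>, then the predicted decrease is linear in a small radius, while
  the model error is quadratic, so a sufficiently small radius makes the step acceptable and is not
  reduced. Hence the radii stay above some \<open>\<mu> > 0\<close>. Each step with \<open>\<rho> k \<ge> 1/4\<close> then decreases \<open>f\<close> by a fixed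
  amount, which can happen only finitely often as \<open>f\<close> is bounded below; but after the last such step the
  radii decrease geometrically to \<open>0\<close>.
\<close>

lemma trust_region_liminf:
  fixes f fp g h \<Delta> \<rho> pred :: "nat \<Rightarrow> real" and full :: "nat \<Rightarrow> bool"
  assumes g: "\<And>k. 0 \<le> g k"
    and h: "\<And>k. 0 \<le> h k" "\<And>k. h k \<le> C"
    and \<Delta>: "0 < \<Delta> 0" "\<And>k. \<Delta> k \<le> D"
    and pos: "\<And>k. 0 < pred k"
    and decrease: "\<And>k. pred k \<ge> c * g k * (if h k = 0 then \<Delta> k else min (\<Delta> k) (g k / h k))" "0 < c"
    and model: "\<And>k. \<bar>f k - fp k - pred k\<bar> \<le> E * (\<Delta> k)\<^sup>2"
    and \<rho>: "\<And>k. \<rho> k = (f k - fp k) / pred k"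
    and \<Delta>_Suc: "\<And>k. \<Delta> (Suc k) = (if \<rho> k < 1/4 then 1/4 * \<Delta> k
           else if \<rho> k > 3/4 \<and> full k then min (2 * \<Delta> k) D else \<Delta> k)"
    and f_Suc: "\<And>k. f (Suc k) = (if \<rho> k > rtil then fp k else f k)"
    and rtil: "0 \<le> rtil" "rtil < 1/4"
    and below: "\<And>k. f k \<ge> l"
  shows "liminf (\<lambda>k. ereal (g k)) = 0"
proof (rule ccontr)
  assume "liminf (\<lambda>k. ereal (g k)) \<noteq> 0"
  moreover have "liminf (\<lambda>k. ereal (g k)) \<ge> 0" using g by (intro Liminf_bounded) auto
  ultimately have "liminf (\<lambda>k. ereal (g k)) > 0" by simp
  then obtain \<epsilon> where \<epsilon>: "0 < ereal \<epsilon>" "ereal \<epsilon> < liminf (\<lambda>k. ereal (g k))"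
    using ereal_dense2 by blast
  have "eventually (\<lambda>k. ereal \<epsilon> < ereal (g k)) sequentially" by (rule less_LiminfD[OF \<epsilon>(2)])
  then obtain K where K: "\<And>k. k \<ge> K \<Longrightarrow> \<epsilon> \<le> g k" 
    by (auto simp: eventually_sequentially intro: less_imp_le)
  have e0: "\<epsilon> > 0" using \<epsilon>(1) by simp
  \<comment> \<open>enlarged constants, so that one can divide by them\<close>
  define C' where "C' = max C 1"
  define E' where "E' = max E 1"
  have C': "C' > 0" "\<And>k. h k \<le> C'" using h(2) by (auto simp: C'_def le_max_iff_disj)
  have E': "E' > 0" "E \<le> E'" by (auto simp: E'_def)
  have \<Delta>_pos: "0 < \<Delta> k" for k
  proof (induction k)
    case (Suc k)
    then show ?case using \<Delta>(1) \<Delta>(2)[of 0] by (auto simp: \<Delta>_Suc)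
  qed (rule \<Delta>(1))
  have pred: "pred k \<ge> c * \<epsilon> * min (\<Delta> k) (\<epsilon> / C')" if k: "k \<ge> K" for k
  proof -
    have "min (\<Delta> k) (\<epsilon> / C') \<le> (if h k = 0 then \<Delta> k else min (\<Delta> k) (g k / h k))"
    proof (cases "h k = 0")
      case False
      then have "h k > 0" using h(1)[of k] by simp
      then have "\<epsilon> / C' \<le> g k / h k" using C'(2)[of k] K[OF k] e0 by (intro frac_le) auto
      then show ?thesis using False by auto
    qed simp
    moreover have "0 \<le> min (\<Delta> k) (\<epsilon> / C')" using \<Delta>_pos[of k] e0 C'(1) by auto
    ultimately have "c * \<epsilon> * min (\<Delta> k) (\<epsilon> / C')
        \<le> c * g k * (if h k = 0 then \<Delta> k else min (\<Delta> k) (g k / h k))"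
      using K[OF k] decrease(2) g[of k] e0 by (intro mult_mono) auto
    with decrease(1)[of k] show ?thesis by linarith
  qed
  \<comment> \<open>below this radius the model error is at most half of the predicted decrease\<close>
  define \<tau> where "\<tau> = min (\<epsilon> / C') (c * \<epsilon> / (2 * E'))"
  have \<tau>: "\<tau> > 0" using e0 C' E' decrease(2) by (simp add: \<tau>_def)
  have good: "\<rho> k \<ge> 1/4" if k: "k \<ge> K" and small: "\<Delta> k \<le> \<tau>" for k
  proof -
    have "pred k \<ge> c * \<epsilon> * \<Delta> k" using pred[OF k] small by (simp add: \<tau>_def min_def split: if_splits)
    moreover have "E * (\<Delta> k)\<^sup>2 \<le> c * \<epsilon> * \<Delta> k / 2"
    proof -
      have "E' * \<Delta> k \<le> c * \<epsilon> / 2" using small E'(1) by (simp add: \<tau>_def field_simps)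
      then have "E' * \<Delta> k * \<Delta> k \<le> c * \<epsilon> / 2 * \<Delta> k" using \<Delta>_pos[of k] by (intro mult_right_mono) auto
      moreover have "E * (\<Delta> k)\<^sup>2 \<le> E' * (\<Delta> k)\<^sup>2" using E'(2) by (intro mult_right_mono) auto
      ultimately show ?thesis by (simp add: power2_eq_square)
    qed
    ultimately have "f k - fp k \<ge> pred k / 2" using model[of k] by linarith
    then show ?thesis using pos[of k] by (simp add: \<rho> field_simps)
  qed
  \<comment> \<open>a radius above \<open>\<tau>\<close> may be reduced once, to no less than \<open>\<tau> / 4\<close>\<close>
  define \<mu> where "\<mu> = min (\<Delta> K) (\<tau> / 4)"
  have \<mu>0: "\<mu> > 0" using \<tau> \<Delta>_pos by (simp add: \<mu>_def)
  have \<mu>: "\<mu> \<le> \<Delta> (K + n)" for n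
  proof (induction n)
    case (Suc n)
    show ?case
    proof (cases "\<Delta> (K + n) \<le> \<tau>")
      case True
      then have "\<rho> (K + n) \<ge> 1/4" by (intro good) auto
      then show ?thesis using Suc \<Delta>(2)[of "K + n"] \<Delta>_pos[of "K + n"] by (auto simp: \<Delta>_Suc)
    next
      case False
      then have "\<Delta> (Suc (K + n)) \<ge> \<tau> / 4"
        using \<Delta>(2)[of "K + n"] \<tau> by (auto simp: \<Delta>_Suc)
      then show ?thesis by (simp add: \<mu>_def)
    qed
  qed (simp add: \<mu>_def)
  have dec: "f (Suc k) \<le> f k" for k
  proof (cases "\<rho> k > rtil")
    case True
    then have "0 < (f k - fp k) / pred k" using rtil(1) by (simp add: \<rho>)
    then show ?thesis using True pos[of k] by (simp add: f_Suc zero_less_divide_iff)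
  qed (simp add: f_Suc)
  have "convergent f"
    by (rule decseq_convergent[of f l]) (use dec below in \<open>auto intro: decseq_SucI convergentI\<close>)
  then obtain L where L: "f \<longlonglongrightarrow> L" by (auto simp: convergent_def)
  have "(\<lambda>k. f k - f (Suc k)) \<longlonglongrightarrow> L - L" by (intro tendsto_diff L LIMSEQ_Suc)
  moreover define \<eta> where "\<eta> = c * \<epsilon> * min \<mu> (\<epsilon> / C') / 4"
  have "\<eta> > 0" using decrease(2) e0 \<mu>0 C'(1) by (simp add: \<eta>_def)
  ultimately have "eventually (\<lambda>k. f k - f (Suc k) < \<eta>) sequentially"
    by (intro order_tendstoD(2)) auto
  then obtain K' where K': "\<And>k. k \<ge> K' \<Longrightarrow> f k - f (Suc k) < \<eta>" by (auto simp: eventually_sequentially)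
  define K2 where "K2 = max K K'"
  have bad: "\<rho> k < 1/4" if k: "k \<ge> K2" for k
  proof (rule ccontr)
    assume "\<not> \<rho> k < 1/4"
    then have r: "\<rho> k \<ge> 1/4" by simp
    have kK: "k \<ge> K" using k by (simp add: K2_def)
    then obtain n where n: "k = K + n" using le_Suc_ex by blast
    have "min \<mu> (\<epsilon> / C') \<le> min (\<Delta> k) (\<epsilon> / C')" using \<mu>[of n] n by auto
    then have "c * \<epsilon> * min \<mu> (\<epsilon> / C') \<le> c * \<epsilon> * min (\<Delta> k) (\<epsilon> / C')"
      using decrease(2) e0 by (intro mult_left_mono) auto
    with pred[OF kK] have "4 * \<eta> \<le> pred k" by (simp add: \<eta>_def)
    moreover have "f k - f (Suc k) = f k - fp k" using r rtil by (simp add: f_Suc)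
    moreover have "f k - fp k \<ge> pred k / 4" using r pos[of k] by (simp add: \<rho> field_simps)
    ultimately show False using K'[of k] k by (simp add: K2_def)
  qed
  have "\<Delta> (K2 + n) = (1/4) ^ n * \<Delta> K2" for n
    by (induction n) (use bad in \<open>auto simp: \<Delta>_Suc\<close>)
  moreover have "(\<lambda>n. (1/4) ^ n * \<Delta> K2) \<longlonglongrightarrow> 0 * \<Delta> K2" for n
    by (intro tendsto_mult_right LIMSEQ_realpow_zero) auto
  ultimately have "(\<lambda>n. \<Delta> (K2 + n)) \<longlonglongrightarrow> 0" by simp
  moreover have "\<mu> \<le> \<Delta> (K2 + n)" for n
    using \<mu>[of "K2 + n - K"] by (simp add: K2_def)
  ultimately have "\<mu> \<le> 0" by (intro LIMSEQ_le_const) auto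
  with \<mu>0 show False by simp
qed

section \<open>The corrected retraction as an implicit function\<close>

lemmas has_derivative_blinfun_compose_left =
  bounded_bilinear.bounded_linear_right[OF bounded_bilinear_blinfun_compose, THEN bounded_linear.has_derivative]
lemmas has_derivative_blinfun_compose_right =
  bounded_bilinear.bounded_linear_left[OF bounded_bilinear_blinfun_compose, THEN bounded_linear.has_derivative]

text \<open>
  \<open>F\<close> models a retraction extended to the whole space by a projection onto the tangent space, \<open>S\<close> the
  direction map of the correction and \<open>Q\<close> the projection onto the constrained tangent space. Composing
  with \<open>Q\<close> extends all maps from that subspace to the ambient space, so that derivatives need not be
  taken within a subspace. The correction \<open>\<delta> v\<close> solves \<open>B (F (Q v - S d)) = c\<close>; with \<open>\<Lambda>\<close> the inverse of \<open>B S\<close>,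
  this is a fixed-point problem for a simplified Newton iteration, whose contraction factor is \<open>1/2\<close>
  within the radii \<open>D\<close> and \<open>r\<close>.
\<close>

locale constraint_correction =
  fixes F :: "'e::banach \<Rightarrow> 'e" and F' :: "'e \<Rightarrow> 'e \<Rightarrow>\<^sub>L 'e" and F'' :: "'e \<Rightarrow> 'e \<Rightarrow> 'e \<Rightarrow>\<^sub>L 'e"
    and B :: "'e \<Rightarrow>\<^sub>L 'y::banach" and c :: 'y and S :: "'y \<Rightarrow>\<^sub>L 'e" and \<Lambda> :: "'y \<Rightarrow>\<^sub>L 'y"
    and Q :: "'e \<Rightarrow>\<^sub>L 'e" and D r :: real
  assumes F: "\<And>u. (F has_derivative F' u) (at u)"
    and F': "\<And>u. (F' has_derivative F'' u) (at u)"
    and start: "B (F 0) = c"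
    and F'_Q: "\<And>v. F' 0 (Q v) = Q v" and F'_S: "\<And>d. F' 0 (S d) = S d"
    and B_Q: "\<And>v. B (Q v) = 0"
    and \<Lambda>_left: "\<And>d. \<Lambda> (B (S d)) = d" and \<Lambda>_inj: "\<And>z. \<Lambda> z = 0 \<Longrightarrow> z = 0"
    and radii: "0 < D" "0 \<le> r"
    and contract: "\<And>v d k. \<lbrakk>norm v < D; norm d \<le> r\<rbrakk> \<Longrightarrow>
          norm (k - \<Lambda> (B (F' (Q v - S d) (S k)))) \<le> 1/2 * norm k"
    and first_defect: "\<And>v. norm v < D \<Longrightarrow> norm (\<Lambda> (B (F (Q v)) - c)) \<le> r / 2"
begin

definition \<Phi> :: "'e \<times> 'y \<Rightarrow> 'y"
  where "\<Phi> p = snd p + \<Lambda> (B (F (Q (fst p) - S (snd p))) - c)"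

lemma fixed_point_iff: "\<Phi> (v, d) = d \<longleftrightarrow> B (F (Q v - S d)) = c"
  using \<Lambda>_inj[of "B (F (Q v - S d)) - c"] by (auto simp: \<Phi>_def blinfun.zero_right)

lemma \<Phi>_has_derivative:
  "(\<Phi> has_derivative (\<lambda>q. snd q + \<Lambda> (B (F' (Q v - S d) (Q (fst q) - S (snd q)))))) (at (v, d))"
proof -
  have "((\<lambda>p. F (Q (fst p) - S (snd p))) has_derivative
      (\<lambda>q. F' (Q (fst (v, d)) - S (snd (v, d))) (Q (fst q) - S (snd q)))) (at (v, d))"
    by (rule has_derivative_compose[OF _ F]) (auto intro!: derivative_eq_intros)
  then show ?thesis unfolding \<Phi>_def[abs_def] by (auto intro!: derivative_eq_intros)
qed

lemma \<Phi>_contraction: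
  assumes v: "norm v < D" and d: "norm d \<le> r" "norm d' \<le> r"
  shows "norm (\<Phi> (v, d) - \<Phi> (v, d')) \<le> 1/2 * norm (d - d')"
proof (rule differentiable_bound[where S = "cball 0 r" and f = "\<lambda>d. \<Phi> (v, d)"
      and f' = "\<lambda>d k. k - \<Lambda> (B (F' (Q v - S d) (S k)))"])
  fix d :: 'y assume "d \<in> cball 0 r"
  then have d: "norm d \<le> r" by simp
  have pair: "((\<lambda>d. (v, d)) has_derivative (\<lambda>k. (0, k))) (at d)"
    by (auto intro!: derivative_eq_intros)
  show "((\<lambda>d. \<Phi> (v, d)) has_derivative (\<lambda>k. k - \<Lambda> (B (F' (Q v - S d) (S k))))) (at d within cball 0 r)"
    using has_derivative_compose[OF pair, OF \<Phi>_has_derivative]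
    by (simp add: blinfun.zero_right blinfun.minus_right has_derivative_at_withinI)
  show "onorm (\<lambda>k. k - \<Lambda> (B (F' (Q v - S d) (S k)))) \<le> 1/2"
    by (rule onorm_bound) (use contract[OF v d] in auto)
qed (use d in auto)

text \<open>The ball of radius \<open>r\<close> is mapped to itself: the iteration moves \<open>0\<close> by at most \<open>r / 2\<close>, and contraction
  contributes at most another \<open>r / 2\<close>.\<close>

lemma correction_unique:
  assumes v: "norm v < D"
  shows "\<exists>!d. norm d \<le> r \<and> B (F (Q v - S d)) = c"
proof -
  have "\<exists>!d. d \<in> cball 0 r \<and> \<Phi> (v, d) = d"
  proof (rule Banach_fix[where c = "1/2"])
    show "complete (cball (0::'y) r)" by (simp add: complete_eq_closed)
    show "(\<lambda>d. \<Phi> (v, d)) ` cball 0 r \<subseteq> cball 0 r"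
    proof safe
      fix d :: 'y assume "d \<in> cball 0 r"
      then have d: "norm d \<le> r" by simp
      have "norm (\<Phi> (v, d)) \<le> norm (\<Phi> (v, d) - \<Phi> (v, 0)) + norm (\<Phi> (v, 0))"
        by (metis add.commute norm_triangle_sub)
      also have "\<dots> \<le> 1/2 * norm (d - 0) + r / 2"
        using \<Phi>_contraction[OF v d, of 0] first_defect[OF v] radii by (intro add_mono) (auto simp: \<Phi>_def blinfun.zero_right)
      also have "\<dots> \<le> r" using d by simp
      finally show "\<Phi> (v, d) \<in> cball 0 r" by simp
    qed
    show "dist (\<Phi> (v, d)) (\<Phi> (v, d')) \<le> 1/2 * dist d d'" if "d \<in> cball 0 r" "d' \<in> cball 0 r" for d d'
      using that \<Phi>_contraction[OF v] unfolding dist_norm mem_cball by simp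
    show "cball (0::'y) r \<noteq> {}" using radii by simp
  qed auto
  then show ?thesis unfolding fixed_point_iff by simp
qed

definition \<delta> :: "'e \<Rightarrow> 'y"
  where "\<delta> v = (THE d. norm d \<le> r \<and> B (F (Q v - S d)) = c)"

lemma \<delta>: "norm v < D \<Longrightarrow> norm (\<delta> v) \<le> r" "norm v < D \<Longrightarrow> B (F (Q v - S (\<delta> v))) = c"
  unfolding \<delta>_def using theI'[OF correction_unique[of v]] by blast+

lemma \<delta>_0: "\<delta> 0 = 0"
  unfolding \<delta>_def
proof (rule the1_equality)
  show "\<exists>!d. norm d \<le> r \<and> B (F (Q 0 - S d)) = c" by (rule correction_unique) (simp add: radii)
  show "norm (0::'y) \<le> r \<and> B (F (Q 0 - S 0)) = c" using radii start by (simp add: blinfun.zero_right)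
qed

lemma eventually_in_ball: "norm v < D \<Longrightarrow> eventually (\<lambda>w. norm w < D) (nhds v)"
  using eventually_nhds_in_open[of "ball 0 D" v] by simp

definition \<delta>' :: "'e \<Rightarrow> 'e \<Rightarrow>\<^sub>L 'y"
  where "\<delta>' v = (SOME G. (\<delta> has_derivative blinfun_apply G) (at v))"

text \<open>The second part is the constraint differentiated along \<open>h\<close>.\<close>

lemma \<delta>_has_derivative:
  assumes v: "norm v < D"
  shows "(\<delta> has_derivative \<delta>' v) (at v)"
    and "B (F' (Q v - S (\<delta> v)) (Q h - S (\<delta>' v h))) = 0"
proof -
  obtain G where G: "(\<delta> has_derivative blinfun_apply G) (at v)"
    "\<And>h. G h = snd (h, G h) + \<Lambda> (B (F' (Q v - S (\<delta> v)) (Q (fst (h, G h)) - S (snd (h, G h)))))"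
  proof (rule fixed_point_has_derivative[where \<Phi> = \<Phi> and \<delta> = \<delta> and q = "1/2"])
    show "eventually (\<lambda>w. \<delta> w = \<Phi> (w, \<delta> w)) (nhds v)"
      using eventually_in_ball[OF v] by eventually_elim (rule fixed_point_iff[THEN iffD2, OF \<delta>(2), symmetric])
    show "eventually (\<lambda>w. norm (\<Phi> (w, \<delta> w) - \<Phi> (w, \<delta> v)) \<le> 1/2 * norm (\<delta> w - \<delta> v)) (nhds v)"
      using eventually_in_ball[OF v] by eventually_elim (intro \<Phi>_contraction \<delta>(1) v)
    show "(\<Phi> has_derivative (\<lambda>q. snd q + \<Lambda> (B (F' (Q v - S (\<delta> v)) (Q (fst q) - S (snd q)))))) (at (v, \<delta> v))"
      by (rule \<Phi>_has_derivative)
    show "norm (snd (0, k) + \<Lambda> (B (F' (Q v - S (\<delta> v)) (Q (fst (0, k)) - S (snd (0, k)))))) \<le> 1/2 * norm k" for k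
      using contract[OF v \<delta>(1)[OF v], of k] by (simp add: blinfun.bilinear_simps)
  qed auto
  from someI[where P = "\<lambda>G. (\<delta> has_derivative blinfun_apply G) (at v)", OF G(1)]
  show 1: "(\<delta> has_derivative \<delta>' v) (at v)" by (simp add: \<delta>'_def)
  have "\<delta>' v = G" using has_derivative_unique[OF 1 G(1)] by (simp add: blinfun_apply_inject)
  then have "\<Lambda> (B (F' (Q v - S (\<delta> v)) (Q h - S (\<delta>' v h)))) = 0"
    using G(2)[of h] by simp
  then show "B (F' (Q v - S (\<delta> v)) (Q h - S (\<delta>' v h))) = 0" by (rule \<Lambda>_inj)
qed

definition u :: "'e \<Rightarrow> 'e" where "u v = Q v - S (\<delta> v)"
definition u' :: "'e \<Rightarrow> 'e \<Rightarrow>\<^sub>L 'e" where "u' v = Q - (S o\<^sub>L \<delta>' v)"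

lemma u_0: "u 0 = 0" by (simp add: u_def \<delta>_0 blinfun.zero_right)

lemma u_has_derivative:
  assumes "norm v < D" shows "(u has_derivative u' v) (at v)"
  unfolding u_def[abs_def] u'_def
  by (rule derivative_eq_intros \<delta>_has_derivative(1)[OF assms] refl)+
    (simp add: blinfun.diff_left fun_eq_iff blinfun.zero_left)

text \<open>To first order the retraction maps \<open>Q h\<close> to itself, which already satisfies the linearized constraint;
  so the correction is of second order.\<close>

lemma \<delta>'_0: "\<delta>' 0 = 0"
proof (rule blinfun_eqI)
  fix h
  show "\<delta>' 0 h = (0 :: 'e \<Rightarrow>\<^sub>L 'y) h"
    using \<delta>_has_derivative(2)[of 0 h] radii \<Lambda>_left[of "\<delta>' 0 h"]
    by (simp add: \<delta>_0 F'_S F'_Q B_Q blinfun.bilinear_simps)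
qed

lemma u'_0: "u' 0 = Q" by (simp add: u'_def \<delta>'_0)

lemma F'_u_has_derivative:
  assumes "norm v < D"
  shows "((\<lambda>v. F' (u v)) has_derivative (\<lambda>h. F'' (u v) (u' v h))) (at v)"
  by (rule has_derivative_compose[OF u_has_derivative[OF assms] F'])

text \<open>The differentiated fixed-point equation reads \<open>\<delta>' v = b v + A v \<delta>' v\<close>, where \<open>b\<close> comes from the first and \<open>A\<close>
  from the second argument of \<open>\<Phi>\<close>.\<close>

definition b :: "'e \<Rightarrow> 'e \<Rightarrow>\<^sub>L 'y" where "b v = \<Lambda> o\<^sub>L (B o\<^sub>L (F' (u v) o\<^sub>L Q))"
definition A :: "'e \<Rightarrow> 'y \<Rightarrow>\<^sub>L 'y" where "A v = id_blinfun - (\<Lambda> o\<^sub>L (B o\<^sub>L (F' (u v) o\<^sub>L S)))"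

lemma \<delta>'_fixed_point:
  assumes "norm v < D" shows "\<delta>' v = b v + (A v o\<^sub>L \<delta>' v)"
proof (rule blinfun_eqI)
  fix h
  have "\<Lambda> (B (F' (u v) (Q h - S (\<delta>' v h)))) = 0"
    using \<delta>_has_derivative(2)[OF assms, of h] by (simp add: u_def blinfun.zero_right)
  then show "\<delta>' v h = (b v + (A v o\<^sub>L \<delta>' v)) h"
    by (simp add: b_def A_def blinfun.bilinear_simps)
qed

lemma A_le_half:
  assumes v: "norm v < D" shows "norm (A v) \<le> 1/2"
proof (rule norm_blinfun_bound)
  show "norm (A v k) \<le> 1/2 * norm k" for k
    using contract[OF v \<delta>(1)[OF v], of k] by (simp add: A_def u_def blinfun.diff_left)
qed simp

text \<open>The fixed-point theorem applied once more, now to the affine equation for \<open>\<delta>'\<close>. At \<open>0\<close> both \<open>A\<close> and \<open>\<delta>'\<close>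
  vanish, so only the derivative of \<open>b\<close> remains.\<close>

lemma \<delta>'_has_derivative:
  assumes v: "norm v < D"
  obtains G where "(\<delta>' has_derivative blinfun_apply G) (at v)"
    "v = 0 \<Longrightarrow> \<forall>h. G h = \<Lambda> o\<^sub>L (B o\<^sub>L (F'' 0 (Q h) o\<^sub>L Q))"
proof -
  define b' where "b' h = \<Lambda> o\<^sub>L (B o\<^sub>L (F'' (u v) (u' v h) o\<^sub>L Q))" for h
  define A' where "A' h = - (\<Lambda> o\<^sub>L (B o\<^sub>L (F'' (u v) (u' v h) o\<^sub>L S)))" for h
  have b: "(b has_derivative b') (at v)"
    unfolding b_def[abs_def] b'_def[abs_def]
    by (intro has_derivative_blinfun_compose_left has_derivative_blinfun_compose_right F'_u_has_derivative[OF v])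
  have A: "(A has_derivative A') (at v)"
    unfolding A_def[abs_def] A'_def[abs_def] diff_0[symmetric]
    by (intro has_derivative_diff has_derivative_const has_derivative_blinfun_compose_left
        has_derivative_blinfun_compose_right F'_u_has_derivative[OF v])
  obtain G where G: "(\<delta>' has_derivative blinfun_apply G) (at v)"
    "\<And>h. G h = b' (fst (h, G h)) + ((A v o\<^sub>L snd (h, G h)) + (A' (fst (h, G h)) o\<^sub>L \<delta>' v))"
  proof (rule fixed_point_has_derivative[where \<delta> = \<delta>' and q = "1/2"
        and \<Phi> = "\<lambda>p. b (fst p) + (A (fst p) o\<^sub>L snd p)"])
    show "eventually (\<lambda>w. \<delta>' w = b (fst (w, \<delta>' w)) + (A (fst (w, \<delta>' w)) o\<^sub>L snd (w, \<delta>' w))) (nhds v)"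
      using eventually_in_ball[OF v] by eventually_elim (simp only: fst_conv snd_conv, rule \<delta>'_fixed_point)
    have half: "norm (A w o\<^sub>L E) \<le> 1/2 * norm E" if "norm w < D" for w and E :: "'e \<Rightarrow>\<^sub>L 'y"
      using norm_blinfun_compose[of "A w" E] mult_right_mono[OF A_le_half[OF that], of "norm E"] by simp
    show "eventually (\<lambda>w. norm (b (fst (w, \<delta>' w)) + (A (fst (w, \<delta>' w)) o\<^sub>L snd (w, \<delta>' w)) -
        (b (fst (w, \<delta>' v)) + (A (fst (w, \<delta>' v)) o\<^sub>L snd (w, \<delta>' v)))) \<le> 1/2 * norm (\<delta>' w - \<delta>' v)) (nhds v)"
      using eventually_in_ball[OF v]
      by eventually_elim (use half in \<open>simp add: bounded_bilinear.diff_right[OF bounded_bilinear_blinfun_compose, symmetric]\<close>)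
    have *: "((\<lambda>p. b (fst p)) has_derivative (\<lambda>q. b' (fst q))) (at (v, \<delta>' v))"
      by (rule has_derivative_compose[OF bounded_linear_imp_has_derivative[OF bounded_linear_fst]]) (simp add: b)
    have **: "((\<lambda>p. A (fst p)) has_derivative (\<lambda>q. A' (fst q))) (at (v, \<delta>' v))"
      by (rule has_derivative_compose[OF bounded_linear_imp_has_derivative[OF bounded_linear_fst]]) (simp add: A)
    show "((\<lambda>p. b (fst p) + (A (fst p) o\<^sub>L snd p)) has_derivative
       (\<lambda>q. b' (fst q) + ((A v o\<^sub>L snd q) + (A' (fst q) o\<^sub>L \<delta>' v)))) (at (v, \<delta>' v))"
      using has_derivative_add[OF * bounded_bilinear.FDERIV[OF bounded_bilinear_blinfun_compose **
          bounded_linear_imp_has_derivative[OF bounded_linear_snd]]] by simp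
    show "norm (b' (fst (0, k)) + ((A v o\<^sub>L snd (0, k)) + (A' (fst (0, k)) o\<^sub>L \<delta>' v))) \<le> 1/2 * norm k" for k
      using half[OF v, of k] linear_0[OF has_derivative_linear[OF F'[of "u v"]]]
      by (simp add: b'_def A'_def blinfun.zero_right)
  qed auto
  have "G h = \<Lambda> o\<^sub>L (B o\<^sub>L (F'' 0 (Q h) o\<^sub>L Q))" if "v = 0" for h
  proof -
    have "A 0 = 0"
      by (rule blinfun_eqI) (simp add: A_def u_0 F'_S \<Lambda>_left blinfun.bilinear_simps)
    then show ?thesis using G(2)[of h] that by (simp add: \<delta>'_0 b'_def u_0 u'_0)
  qed
  with G(1) show ?thesis using that by blast
qed

definition \<R> :: "'e \<Rightarrow> 'e" where "\<R> v = F (u v)"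
definition \<R>' :: "'e \<Rightarrow> 'e \<Rightarrow>\<^sub>L 'e" where "\<R>' v = F' (u v) o\<^sub>L u' v"

lemma \<R>_constraint: "norm v < D \<Longrightarrow> B (\<R> v) = c"
  using \<delta>(2) by (simp add: \<R>_def u_def)

lemma \<R>_0: "\<R> 0 = F 0" by (simp add: \<R>_def u_0)

lemma \<R>'_0: "\<R>' 0 = Q"
  by (rule blinfun_eqI) (simp add: \<R>'_def u_0 u'_0 F'_Q)

lemma \<R>_has_derivative: "norm v < D \<Longrightarrow> (\<R> has_derivative \<R>' v) (at v)"
  unfolding \<R>_def[abs_def] \<R>'_def
  using has_derivative_compose[OF u_has_derivative, OF _ F] by (simp add: blinfun_compose.rep_eq comp_def)

text \<open>The second derivative at \<open>0\<close> is that of \<open>F\<close>, corrected along the range of \<open>S\<close> so that it becomes tangent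
  to the constraint. It is therefore bounded by the second derivative of \<open>F\<close> and the norms of \<open>B\<close>, \<open>S\<close> and \<open>\<Lambda>\<close>.\<close>

lemma \<R>'_has_derivative:
  assumes v: "norm v < D"
  obtains G where "(\<R>' has_derivative G) (at v)"
    "v = 0 \<Longrightarrow> \<forall>h k. G h k = F'' 0 (Q h) (Q k) - S (\<Lambda> (B (F'' 0 (Q h) (Q k))))"
proof -
  obtain G where G: "(\<delta>' has_derivative blinfun_apply G) (at v)"
    "v = 0 \<Longrightarrow> \<forall>h. G h = \<Lambda> o\<^sub>L (B o\<^sub>L (F'' 0 (Q h) o\<^sub>L Q))"
    using \<delta>'_has_derivative[OF v] by metis
  have u': "(u' has_derivative (\<lambda>h. - (S o\<^sub>L G h))) (at v)"
    unfolding u'_def[abs_def] diff_0[symmetric]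
    by (intro has_derivative_diff has_derivative_const has_derivative_blinfun_compose_left G(1))
  have "(\<R>' has_derivative (\<lambda>h. (F' (u v) o\<^sub>L (- (S o\<^sub>L G h))) + (F'' (u v) (u' v h) o\<^sub>L u' v))) (at v)"
    unfolding \<R>'_def[abs_def] by (rule bounded_bilinear.FDERIV[OF bounded_bilinear_blinfun_compose F'_u_has_derivative[OF v] u'])
  moreover have "((F' (u v) o\<^sub>L (- (S o\<^sub>L G h))) + (F'' (u v) (u' v h) o\<^sub>L u' v)) k
      = F'' 0 (Q h) (Q k) - S (\<Lambda> (B (F'' 0 (Q h) (Q k))))" if "v = 0" for h k
    using that G(2) by (simp add: u_0 u'_0 blinfun.bilinear_simps F'_S)
  ultimately show ?thesis using that by blast
qed

end

section \<open>Hessians on closed subspaces\<close>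

lemma derivative_unique_on_subspace:
  assumes W: "subspace W" and v: "v \<in> W" and h: "h \<in> W"
    and "(f has_derivative A) (at v within W)" "(f has_derivative A') (at v within W)"
  shows "A h = A' h"
proof -
  have sub: "range (\<lambda>t. v + t *\<^sub>R h) \<subseteq> W" using W v h by (auto intro: subspace_add subspace_scale)
  have line: "((\<lambda>t. v + t *\<^sub>R h) has_derivative (\<lambda>t. t *\<^sub>R h)) (at (0::real))"
    by (auto intro!: derivative_eq_intros)
  have "((\<lambda>t. f (v + t *\<^sub>R h)) has_derivative (\<lambda>t. A (t *\<^sub>R h))) (at (0::real))"
    if "(f has_derivative A) (at v within W)" for A
    using diff_chain_within[OF line, of f A] has_derivative_subset[OF that sub] by (simp add: o_def)
  from has_derivative_unique[OF this[OF assms(4)] this[OF assms(5)]]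
  have "A (1 *\<^sub>R h) = A' (1 *\<^sub>R h)" by meson
  then show ?thesis by simp
qed

text \<open>The gradient on \<open>W\<close> is the projected Riesz representative of the differential of \<open>f\<close>, a bounded linear
  image of \<open>f'\<close>, and is thus differentiable together with \<open>f'\<close>.\<close>

lemma hess_on_of_extension:
  fixes W :: "'e::{real_inner,banach} set" and f :: "'e \<Rightarrow> real" and f' :: "'e \<Rightarrow> 'e \<Rightarrow>\<^sub>L real"
    and f'' :: "'e \<Rightarrow> 'e \<Rightarrow>\<^sub>L real"
  assumes W: "subspace W" "closed W" and D: "0 < D"
    and f: "\<And>v. norm v < D \<Longrightarrow> (f has_derivative f' v) (at v)"
    and f': "(f' has_derivative f'') (at 0)"
    and \<phi>: "\<And>v. \<lbrakk>v \<in> W; norm v < D\<rbrakk> \<Longrightarrow> \<phi> v = f v"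
    and \<xi>: "\<xi> \<in> W"
  shows "hess_on W \<phi> 0 \<xi> \<in> W" "\<eta> \<in> W \<Longrightarrow> hess_on W \<phi> 0 \<xi> \<bullet> \<eta> = f'' \<xi> \<eta>"
proof -
  obtain Q :: "'e \<Rightarrow>\<^sub>L 'e" where Q: "\<And>v. Q v \<in> W" "\<And>w. w \<in> W \<Longrightarrow> Q w = w"
      "\<And>v w. w \<in> W \<Longrightarrow> Q v \<bullet> w = v \<bullet> w"
    using closed_subspace_has_projection[OF W] by metis
  obtain G :: "('e \<Rightarrow>\<^sub>L real) \<Rightarrow>\<^sub>L 'e" where G: "\<And>f h. G f \<bullet> h = f h" using riesz_isomorphism by blast
  have 0: "0 \<in> W" using W(1) by (rule subspace_0)
  have grad: "grad_on W \<phi> v = Q (G (f' v))" if v: "v \<in> W" "norm v < D" for v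
  proof -
    have "(f has_derivative f' v) (at v within W)" using f[OF v(2)] by (rule has_derivative_at_withinI)
    then have d: "(\<phi> has_derivative f' v) (at v within W)"
    proof (rule has_derivative_transform_within)
      show "0 < D - norm v" using v(2) by simp
      show "f w = \<phi> w" if "w \<in> W" "dist w v < D - norm v" for w
        using \<phi>[OF that(1)] that(2) norm_triangle_sub[of w v] by (simp add: dist_norm)
    qed (rule v(1))
    have bl: "bounded_linear (\<lambda>h. Q (G (f' v)) \<bullet> h)" by (rule bounded_linear_inner_right)
    have ex: "(\<phi> has_derivative (\<lambda>h. Q (G (f' v)) \<bullet> h)) (at v within W)"
      unfolding has_derivative_within
    proof (intro conjI bl)
      show "((\<lambda>w. (1 / norm (w - v)) *\<^sub>R (\<phi> w - (\<phi> v + Q (G (f' v)) \<bullet> (w - v)))) \<longlongrightarrow> 0) (at v within W)"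
      proof (rule Lim_transform_within[OF _ zero_less_one])
        show "((\<lambda>w. (1 / norm (w - v)) *\<^sub>R (\<phi> w - (\<phi> v + f' v (w - v)))) \<longlongrightarrow> 0) (at v within W)"
          using d unfolding has_derivative_within by blast
      qed (use v W(1) Q G in \<open>auto simp: subspace_diff\<close>)
    qed
    show ?thesis unfolding grad_on_def
    proof (rule the_equality)
      fix g assume g: "g \<in> W \<and> (\<phi> has_derivative (\<lambda>h. g \<bullet> h)) (at v within W)"
      have "g \<bullet> h = Q (G (f' v)) \<bullet> h" if "h \<in> W" for h
        using derivative_unique_on_subspace[OF W(1) v(1) that] g ex by blast
      then have "(g - Q (G (f' v))) \<bullet> (g - Q (G (f' v))) = 0"
        using g Q(1) W(1) by (metis inner_diff_left right_minus_eq subspace_diff)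
      then show "g = Q (G (f' v))" by simp
    qed (use Q(1) ex in blast)
  qed
  have "((\<lambda>v. Q (G (f' v))) has_derivative (\<lambda>h. Q (G (f'' h)))) (at 0)"
    by (intro blinfun.bounded_linear_right[THEN bounded_linear.has_derivative] f')
  then have "((\<lambda>v. Q (G (f' v))) has_derivative (\<lambda>h. Q (G (f'' h)))) (at 0 within W)"
    by (rule has_derivative_at_withinI)
  then have "(grad_on W \<phi> has_derivative (\<lambda>h. Q (G (f'' h)))) (at 0 within W)"
    by (rule has_derivative_transform_within[OF _ D 0]) (simp add: grad)
  then have "hess_on W \<phi> 0 \<xi> = Q (G (f'' \<xi>))"
    unfolding hess_on_def
    by (intro derivative_unique_on_subspace[OF W(1) 0 \<xi>])
      (auto simp: frechet_derivative_works[symmetric] differentiable_def)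
  then show "hess_on W \<phi> 0 \<xi> \<in> W" "\<eta> \<in> W \<Longrightarrow> hess_on W \<phi> 0 \<xi> \<bullet> \<eta> = f'' \<xi> \<eta>"
    using Q G by auto
qed

section \<open>Operator norms on subspaces and increments\<close>

lemma onorm_on_bound:
  fixes A :: "'a::real_normed_vector \<Rightarrow>\<^sub>L 'b::real_normed_vector"
  assumes "v \<in> T"
  shows "norm (A v) \<le> onorm_on T A * norm v"
proof (cases "v = 0")
  case False
  have "bdd_above ((\<lambda>v. norm (A v) / norm v) ` T)"
  proof (rule bdd_aboveI2)
    show "norm (A v) / norm v \<le> norm A" for v
      using norm_blinfun[of A v] by (cases "v = 0") (auto simp: field_simps)
  qed
  then have "norm (A v) / norm v \<le> onorm_on T A"
    unfolding onorm_on_def by (rule cSUP_upper[OF assms])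
  with False show ?thesis by (simp add: field_simps)
qed (simp add: blinfun.zero_right)

lemma onorm2_on_bound:
  fixes A :: "'a::real_normed_vector \<Rightarrow>\<^sub>L 'a \<Rightarrow>\<^sub>L 'b::real_normed_vector"
  assumes v: "v \<in> T" and w: "w \<in> T"
  shows "norm (A v w) \<le> onorm2_on T (\<lambda>v w. A v w) * norm v * norm w"
proof (cases "v = 0")
  case False
  have le: "onorm_on T (A v) \<le> norm (A v)" for v
    unfolding onorm_on_def
  proof (rule cSUP_least)
    show "norm (A v w) / norm w \<le> norm (A v)" for w
      using norm_blinfun[of "A v" w] by (cases "w = 0") (auto simp: field_simps)
  qed (use v in blast)
  have "bdd_above ((\<lambda>v. onorm_on T (A v) / norm v) ` T)"
  proof (rule bdd_aboveI2)
    show "onorm_on T (A v) / norm v \<le> norm A" for v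
      using order_trans[OF le[of v] norm_blinfun[of A v]] by (cases "v = 0") (auto simp: field_simps)
  qed
  then have "onorm_on T (A v) / norm v \<le> onorm2_on T (\<lambda>v w. A v w)"
    unfolding onorm2_on_def by (rule cSUP_upper[OF v])
  with False have "onorm_on T (A v) \<le> onorm2_on T (\<lambda>v w. A v w) * norm v" by (simp add: field_simps)
  from mult_right_mono[OF this norm_ge_zero[of w]] onorm_on_bound[OF w, of "A v"] show ?thesis by linarith
qed (simp add: blinfun.zero_right blinfun.zero_left)

lemma increment_bound_on_segment:
  fixes f :: "'a::real_normed_vector \<Rightarrow> 'b::real_normed_vector"
  assumes f: "\<And>t. \<lbrakk>0 \<le> t; t \<le> 1\<rbrakk> \<Longrightarrow> (f has_derivative f' t) (at (t *\<^sub>R v))"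
    and C: "\<And>t. \<lbrakk>0 \<le> t; t \<le> 1\<rbrakk> \<Longrightarrow> norm (f' t v) \<le> C"
  shows "norm (f v - f 0) \<le> C"
proof -
  have "norm (f (1 *\<^sub>R v) - f (0 *\<^sub>R v)) \<le> C * norm (1 - 0 :: real)"
  proof (rule differentiable_bound[where S = "{0..1}" and f = "\<lambda>t. f (t *\<^sub>R v)" and f' = "\<lambda>t s. f' t (s *\<^sub>R v)"])
    fix t :: real assume t: "t \<in> {0..1}"
    have 1: "((\<lambda>t. t *\<^sub>R v) has_derivative (\<lambda>s. s *\<^sub>R v)) (at t within {0..1})"
      by (auto intro!: derivative_eq_intros)
    show "((\<lambda>t. f (t *\<^sub>R v)) has_derivative (\<lambda>s. f' t (s *\<^sub>R v))) (at t within {0..1})"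
      using has_derivative_compose[OF 1, OF f] t by simp
    have "f' t (s *\<^sub>R v) = s *\<^sub>R f' t v" for s
      using f t by (intro linear_scale[OF has_derivative_linear]) auto
    then show "onorm (\<lambda>s. f' t (s *\<^sub>R v)) \<le> C"
      using C[of t] t order_trans[OF norm_ge_zero C[of t]]
      by (intro onorm_bound) (auto simp: mult.commute[of C] intro!: mult_left_mono)
  qed auto
  then show ?thesis by simp
qed

section \<open>The constrained manifold at a point of the sublevel set\<close>

definition proj_on :: "'e::{real_inner,banach} set \<Rightarrow> 'e \<Rightarrow>\<^sub>L 'e"
  where "proj_on W = (SOME Q :: 'e \<Rightarrow>\<^sub>L 'e. (\<forall>v. Q v \<in> W \<and> norm (Q v) \<le> norm v) \<and>
      (\<forall>w\<in>W. Q w = w \<and> (\<forall>v. Q v \<bullet> w = v \<bullet> w)))"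

lemma proj_on:
  assumes "subspace W" "closed W"
  shows "proj_on W v \<in> W" "norm (proj_on W v) \<le> norm v" "w \<in> W \<Longrightarrow> proj_on W w = w"
    "w \<in> W \<Longrightarrow> proj_on W v \<bullet> w = v \<bullet> w"
proof -
  have "\<exists>Q :: 'a \<Rightarrow>\<^sub>L 'a. (\<forall>v. Q v \<in> W \<and> norm (Q v) \<le> norm v) \<and>
      (\<forall>w\<in>W. Q w = w \<and> (\<forall>v. Q v \<bullet> w = v \<bullet> w))"
    using closed_subspace_has_projection[OF assms] by metis
  from someI_ex[OF this] have "(\<forall>v. proj_on W v \<in> W \<and> norm (proj_on W v) \<le> norm v) \<and>
      (\<forall>w\<in>W. proj_on W w = w \<and> (\<forall>v. proj_on W v \<bullet> w = v \<bullet> w))"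
    unfolding proj_on_def .
  then show "proj_on W v \<in> W" "norm (proj_on W v) \<le> norm v" "w \<in> W \<Longrightarrow> proj_on W w = w"
    "w \<in> W \<Longrightarrow> proj_on W v \<bullet> w = v \<bullet> w" by blast+
qed

text \<open>The hypotheses on manifold, projection and retraction at a single point \<open>y\<close>. The constants \<open>r\<close> and \<open>\<Delta>\<^sub>s\<close> are
  shared by all points, which makes the bounds below uniform.\<close>

locale constrained_point =
  fixes M :: "'e::{real_inner,banach} set" and B :: "'e \<Rightarrow>\<^sub>L 'y::{real_inner,banach}" and c :: 'y
    and P :: "'e \<Rightarrow> 'e \<Rightarrow>\<^sub>L 'e" and R :: "'e \<Rightarrow> 'e \<Rightarrow> 'e"
    and DR :: "'e \<Rightarrow> 'e \<Rightarrow> 'e \<Rightarrow>\<^sub>L 'e" and D2R :: "'e \<Rightarrow> 'e \<Rightarrow> 'e \<Rightarrow>\<^sub>L 'e \<Rightarrow>\<^sub>L 'e"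
    and y :: 'e and C K\<^sub>P K\<^sub>L \<sigma> K\<^sub>1 K\<^sub>2 r \<Delta>\<^sub>s :: real
  assumes y: "y \<in> M" "B y = c"
    and P_onto: "range (P y) = tangent_space M y"
    and P_id: "v \<in> tangent_space M y \<Longrightarrow> P y v = v"
    and R_M: "v \<in> tangent_space M y \<Longrightarrow> R y v \<in> M"
    and R_C2: "C2_on (tangent_space M y) (R y) (DR y) (D2R y)"
    and R_0: "R y 0 = y"
    and DR_0: "v \<in> tangent_space M y \<Longrightarrow> DR y 0 v = v"
    and coercive: "C > 0" "schur_op B P y d \<bullet> d \<ge> C * (norm d)\<^sup>2"
    and K\<^sub>P: "norm (P y) \<le> K\<^sub>P"
    and K\<^sub>L: "onorm (inv (schur_op B P y)) \<le> K\<^sub>L"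
    and K_pos: "K\<^sub>1 > 0" "K\<^sub>2 > 0"
    and DR_bound: "\<lbrakk>w \<in> tangent_space M y; norm w \<le> \<sigma>\<rbrakk> \<Longrightarrow> onorm_on (tangent_space M y) (DR y w) \<le> K\<^sub>1"
    and D2R_bound: "\<lbrakk>w \<in> tangent_space M y; norm w \<le> \<sigma>\<rbrakk> \<Longrightarrow>
      onorm2_on (tangent_space M y) (\<lambda>v z. D2R y w v z) \<le> K\<^sub>2"
    and r: "r = min (\<sigma> / (2 * K\<^sub>P * norm B)) (1 / (4 * K\<^sub>2 * K\<^sub>L * K\<^sub>P\<^sup>2 * norm B ^ 3))"
    and \<Delta>\<^sub>s: "\<Delta>\<^sub>s = min (\<sigma> / 2) (min (1 / (4 * K\<^sub>2 * K\<^sub>L * K\<^sub>P * (norm B)\<^sup>2)) (r / (2 * K\<^sub>1 * K\<^sub>L * norm B)))"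
    and \<Delta>\<^sub>s_pos: "0 < \<Delta>\<^sub>s"
begin

abbreviation T :: "'e set" where "T \<equiv> tangent_space M y"

definition W :: "'e set" where "W = {v \<in> T. B v = 0}"
text \<open>These maps instantiate the setting of the implicit function above: \<open>B S\<close> is the Schur complement, and
  precomposition with \<open>P y\<close> extends the retraction from the tangent space to the ambient space.\<close>

definition S :: "'y \<Rightarrow>\<^sub>L 'e" where "S = P y o\<^sub>L Blinfun (adjoint B)"
definition \<Lambda> :: "'y \<Rightarrow>\<^sub>L 'y" where "\<Lambda> = Blinfun (inv (schur_op B P y))"
definition Q :: "'e \<Rightarrow>\<^sub>L 'e" where "Q = proj_on W"

definition F :: "'e \<Rightarrow> 'e" where "F u = R y (P y u)"
definition F' :: "'e \<Rightarrow> 'e \<Rightarrow>\<^sub>L 'e" where "F' u = DR y (P y u) o\<^sub>L P y"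
definition F'' :: "'e \<Rightarrow> 'e \<Rightarrow> 'e \<Rightarrow>\<^sub>L 'e" where "F'' u h = D2R y (P y u) (P y h) o\<^sub>L P y"

lemma T_iff: "v \<in> T \<longleftrightarrow> P y v = v"
  using P_onto P_id by (metis rangeI)

lemma P_in_T: "P y v \<in> T" using P_onto by blast

lemma PP [simp]: "P y (P y v) = P y v" by (rule P_id[OF P_in_T])

lemma subspace_T: "subspace T"
  by (auto simp: subspace_def T_iff blinfun.bilinear_simps)

lemma subspace_W: "subspace W" and closed_W: "closed W"
proof -
  show "subspace W" by (auto simp: W_def subspace_def T_iff blinfun.bilinear_simps)
  have "W = {v. P y v = v} \<inter> {v. B v = 0}" by (auto simp: W_def T_iff)
  then show "closed W" by (auto intro!: closed_Int closed_Collect_eq continuous_intros)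
qed

lemma W_T: "v \<in> W \<Longrightarrow> v \<in> T" by (simp add: W_def)

lemmas Q = proj_on[OF subspace_W closed_W, folded Q_def]

lemma S_apply: "S d = P y (adjoint B d)"
  by (simp add: S_def bounded_linear_Blinfun_apply[OF hilbert_adjoint(2)])

lemma schur_eq: "schur_op B P y d = (B o\<^sub>L S) d" by (simp add: schur_op_def S_apply)

lemma S_T: "S d \<in> T" by (simp add: S_apply P_in_T)

lemma Q_T: "Q v \<in> T" using Q(1) by (rule W_T)

lemma \<Lambda>_apply: "\<Lambda> z = inv (schur_op B P y) z" and \<Lambda>_left: "\<Lambda> (B (S d)) = d"
  and \<Lambda>_inj: "\<Lambda> z = 0 \<Longrightarrow> z = 0"
proof -
  have schur: "schur_op B P y = B o\<^sub>L S" by (rule ext) (rule schur_eq)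
  have inv: "bij (B o\<^sub>L S)" "bounded_linear (inv (B o\<^sub>L S))"
    using coercive_inverse[of C "B o\<^sub>L S"] coercive by (auto simp: schur)
  show ap: "\<Lambda> z = inv (schur_op B P y) z" for z
    by (simp add: \<Lambda>_def schur bounded_linear_Blinfun_apply[OF inv(2)])
  show "\<Lambda> (B (S d)) = d" using inv_f_f[OF bij_is_inj[OF inv(1)], of d] by (simp add: ap schur)
  show "z = 0" if "\<Lambda> z = 0"
    using surj_f_inv_f[OF bij_is_surj[OF inv(1)], of z] that by (simp add: ap schur blinfun.zero_right)
qed

lemma norm_\<Lambda>: "norm (\<Lambda> z) \<le> K\<^sub>L * norm z"
proof -
  have "blinfun_apply \<Lambda> = inv (schur_op B P y)" by (rule ext) (rule \<Lambda>_apply)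
  then have "norm \<Lambda> \<le> K\<^sub>L" using K\<^sub>L by (simp add: norm_blinfun.rep_eq)
  then show ?thesis using norm_blinfun[of \<Lambda> z] mult_right_mono[of "norm \<Lambda>" "K\<^sub>L" "norm z"] by simp
qed

lemma norm_S: "norm (S d) \<le> K\<^sub>P * norm B * norm d"
proof -
  have "norm (S d) \<le> norm (P y) * norm (adjoint B d)" unfolding S_apply by (rule norm_blinfun)
  also have "\<dots> \<le> K\<^sub>P * (norm B * norm d)"
    using K\<^sub>P hilbert_adjoint(3)[of B d] by (intro mult_mono) (auto intro: order_trans[OF norm_ge_zero])
  finally show ?thesis by simp
qed

text \<open>If one of the constants vanished, then, as \<open>x / 0 = 0\<close>, one of the terms of the minimum that defines \<open>\<Delta>\<^sub>s\<close>
  would be \<open>0\<close>.\<close>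

lemma constants_pos: "K\<^sub>P > 0" "K\<^sub>L > 0" "norm B > 0" "r > 0" "\<sigma> > 0"
proof -
  have KP0: "K\<^sub>P \<ge> 0" using K\<^sub>P norm_ge_zero order_trans by blast
  have KL0: "K\<^sub>L \<ge> 0" using norm_\<Lambda> K\<^sub>L onorm_pos_le[of "\<Lambda>"]
    by (metis \<Lambda>_apply blinfun.bounded_linear_right ext order_trans)
  have 1: "0 < 1 / (4 * K\<^sub>2 * K\<^sub>L * K\<^sub>P * (norm B)\<^sup>2)" and 2: "0 < r / (2 * K\<^sub>1 * K\<^sub>L * norm B)" and 3: "0 < \<sigma> / 2"
    using \<Delta>\<^sub>s_pos unfolding \<Delta>\<^sub>s by simp_all
  show "\<sigma> > 0" using 3 by simp
  show p: "K\<^sub>P > 0" "K\<^sub>L > 0" "norm B > 0" using 1 KP0 KL0 by (auto simp: less_le)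
  have "0 < 2 * K\<^sub>1 * K\<^sub>L * norm B" using p K_pos by simp
  then show "r > 0" using 2 unfolding zero_less_divide_iff by linarith
qed

text \<open>The four requirements from which the formulas for \<open>r\<close> and \<open>\<Delta>\<^sub>s\<close> arise: two keep arguments of the retraction
  within \<open>\<sigma>\<close>, the third bounds the first step of the iteration by \<open>r / 2\<close>, the fourth makes its contraction
  factor \<open>1/2\<close>.\<close>

lemma radius_bounds:
  "K\<^sub>P * norm B * r \<le> \<sigma> / 2" "\<Delta>\<^sub>s \<le> \<sigma> / 2" "K\<^sub>L * norm B * K\<^sub>1 * \<Delta>\<^sub>s \<le> r / 2"
  "K\<^sub>L * norm B * K\<^sub>2 * (K\<^sub>P * norm B) * (\<Delta>\<^sub>s + K\<^sub>P * norm B * r) \<le> 1/2"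
proof -
  note pos = constants_pos K_pos
  have r1: "r \<le> \<sigma> / (2 * K\<^sub>P * norm B)" and r2: "r \<le> 1 / (4 * K\<^sub>2 * K\<^sub>L * K\<^sub>P\<^sup>2 * norm B ^ 3)"
    unfolding r by auto
  have d1: "\<Delta>\<^sub>s \<le> 1 / (4 * K\<^sub>2 * K\<^sub>L * K\<^sub>P * (norm B)\<^sup>2)" and d2: "\<Delta>\<^sub>s \<le> r / (2 * K\<^sub>1 * K\<^sub>L * norm B)"
    unfolding \<Delta>\<^sub>s by auto
  show "K\<^sub>P * norm B * r \<le> \<sigma> / 2" using r1 pos by (simp add: field_simps)
  show "\<Delta>\<^sub>s \<le> \<sigma> / 2" unfolding \<Delta>\<^sub>s by simp
  show "K\<^sub>L * norm B * K\<^sub>1 * \<Delta>\<^sub>s \<le> r / 2" using d2 pos by (simp add: field_simps)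
  have "4 * K\<^sub>2 * K\<^sub>L * K\<^sub>P\<^sup>2 * norm B ^ 3 * r \<le> 1" using r2 pos by (simp add: field_simps)
  moreover have "4 * K\<^sub>2 * K\<^sub>L * K\<^sub>P * (norm B)\<^sup>2 * \<Delta>\<^sub>s \<le> 1" using d1 pos by (simp add: field_simps)
  ultimately show "K\<^sub>L * norm B * K\<^sub>2 * (K\<^sub>P * norm B) * (\<Delta>\<^sub>s + K\<^sub>P * norm B * r) \<le> 1/2"
    by (simp add: algebra_simps power2_eq_square power3_eq_cube)
qed

lemma F_has_derivative: "(F has_derivative F' u) (at u)"
proof -
  have "(R y has_derivative DR y (P y u)) (at (P y u) within range (P y))"
    using R_C2 P_in_T unfolding C2_on_def P_onto by blast
  from diff_chain_within[OF bounded_linear_imp_has_derivative[OF blinfun.bounded_linear_right] this]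
  show ?thesis by (simp add: F_def[abs_def] F'_def o_def blinfun_compose.rep_eq)
qed

lemma F'_has_derivative: "(F' has_derivative F'' u) (at u)"
proof -
  have "(DR y has_derivative D2R y (P y u)) (at (P y u) within range (P y))"
    using R_C2 P_in_T unfolding C2_on_def P_onto by blast
  from diff_chain_within[OF bounded_linear_imp_has_derivative[OF blinfun.bounded_linear_right] this]
  have "((\<lambda>u. DR y (P y u)) has_derivative (\<lambda>h. D2R y (P y u) (P y h))) (at u)" by (simp add: o_def)
  then show ?thesis unfolding F'_def[abs_def] F''_def[abs_def]
    by (rule has_derivative_blinfun_compose_right)
qed

lemma F''_bound:
  assumes "w \<in> T" "norm w \<le> \<sigma>" "h \<in> T" "k \<in> T"
  shows "norm (F'' w h k) \<le> K\<^sub>2 * norm h * norm k"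
proof -
  have "norm (F'' w h k) = norm (D2R y w h k)" using assms by (simp add: F''_def P_id)
  also have "\<dots> \<le> onorm2_on T (\<lambda>v z. D2R y w v z) * norm h * norm k"
    by (rule onorm2_on_bound) fact+
  also have "\<dots> \<le> K\<^sub>2 * norm h * norm k"
    using D2R_bound[OF assms(1,2)] by (intro mult_right_mono) auto
  finally show ?thesis .
qed

lemma norm_scaled_le:
  fixes w :: 'e
  assumes "0 \<le> t" "t \<le> 1" "norm w \<le> \<sigma>" shows "norm (t *\<^sub>R w) \<le> \<sigma>"
  using mult_right_mono[OF assms(2) norm_ge_zero[of w]] assms by simp

lemma F_increment:
  assumes "w \<in> T" "norm w \<le> \<sigma>" shows "norm (F w - F 0) \<le> K\<^sub>1 * norm w"
proof (rule increment_bound_on_segment[OF F_has_derivative])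
  fix t :: real assume t: "0 \<le> t" "t \<le> 1"
  have tw: "t *\<^sub>R w \<in> T" using subspace_T assms(1) by (rule subspace_scale)
  have "norm (F' (t *\<^sub>R w) w) = norm (DR y (t *\<^sub>R w) w)" using assms tw by (simp add: F'_def P_id)
  also have "\<dots> \<le> onorm_on T (DR y (t *\<^sub>R w)) * norm w" by (rule onorm_on_bound) fact
  also have "\<dots> \<le> K\<^sub>1 * norm w"
    using DR_bound[OF tw norm_scaled_le[OF t assms(2)]] by (intro mult_right_mono) auto
  finally show "norm (F' (t *\<^sub>R w) w) \<le> K\<^sub>1 * norm w" .
qed

lemma F'_0: "h \<in> T \<Longrightarrow> F' 0 h = h"
  by (simp add: F'_def P_id DR_0 blinfun.zero_right)

lemma F'_increment:
  assumes "w \<in> T" "norm w \<le> \<sigma>" "h \<in> T" shows "norm (F' w h - h) \<le> K\<^sub>2 * norm w * norm h"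
proof -
  have "norm (F' w h - F' 0 h) \<le> K\<^sub>2 * norm w * norm h"
  proof (rule increment_bound_on_segment[where f = "\<lambda>u. F' u h" and f' = "\<lambda>t k. F'' (t *\<^sub>R w) k h"])
    fix t :: real assume t: "0 \<le> t" "t \<le> 1"
    show "((\<lambda>u. F' u h) has_derivative (\<lambda>k. F'' (t *\<^sub>R w) k h)) (at (t *\<^sub>R w))"
      by (rule bounded_linear.has_derivative[OF blinfun.bounded_linear_left F'_has_derivative])
    show "norm (F'' (t *\<^sub>R w) w h) \<le> K\<^sub>2 * norm w * norm h"
      using assms norm_scaled_le[OF t assms(2)] subspace_T by (intro F''_bound subspace_scale)
  qed
  then show ?thesis using F'_0[OF assms(3)] by simp
qed

text \<open>
  Since \<open>\<Lambda> (B (S k)) = k\<close>, the deviation from the identity in the contraction estimate is the image under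
  \<open>\<Lambda> B\<close> of the increment of \<open>F'\<close> between \<open>0\<close> and the current argument, applied to \<open>S k\<close>; it is controlled by the
  bound on the second derivative. The first defect is in the same way controlled by the bound on \<open>F'\<close>.
\<close>

sublocale constraint_correction F F' F'' B c S \<Lambda> Q \<Delta>\<^sub>s r
proof
  show "(F has_derivative F' u) (at u)" for u by (rule F_has_derivative)
  show "(F' has_derivative F'' u) (at u)" for u by (rule F'_has_derivative)
  show "B (F 0) = c" by (simp add: F_def R_0 y blinfun.zero_right)
  show "F' 0 (Q v) = Q v" for v by (rule F'_0[OF Q_T])
  show "F' 0 (S d) = S d" for d by (rule F'_0[OF S_T])
  show "B (Q v) = 0" for v using Q(1)[of v] by (simp add: W_def)
  show "\<Lambda> (B (S d)) = d" for d by (rule \<Lambda>_left)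
  show "z = 0" if "\<Lambda> z = 0" for z using that by (rule \<Lambda>_inj)
  show "0 < \<Delta>\<^sub>s" by (rule \<Delta>\<^sub>s_pos)
  show "0 \<le> r" using constants_pos by simp
next
  fix v :: 'e and d k :: 'y assume v: "norm v < \<Delta>\<^sub>s" and d: "norm d \<le> r"
  let ?w = "Q v - S d"
  have wT: "?w \<in> T" using subspace_T Q_T S_T by (rule subspace_diff)
  have "norm ?w \<le> norm (Q v) + norm (S d)" by (rule norm_triangle_ineq4)
  also have "\<dots> \<le> \<Delta>\<^sub>s + K\<^sub>P * norm B * r"
    using Q(2)[of v] v order_trans[OF norm_S[of d] mult_left_mono[OF d, of "K\<^sub>P * norm B"]] constants_pos
    by simp
  finally have w: "norm ?w \<le> \<Delta>\<^sub>s + K\<^sub>P * norm B * r" .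
  then have ws: "norm ?w \<le> \<sigma>" using radius_bounds(1,2) by linarith
  note nonneg = constants_pos[THEN less_imp_le] K_pos[THEN less_imp_le]
  have "k - \<Lambda> (B (F' ?w (S k))) = - \<Lambda> (B (F' ?w (S k) - S k))"
    by (simp add: blinfun.diff_right \<Lambda>_left)
  then have "norm (k - \<Lambda> (B (F' ?w (S k)))) \<le> K\<^sub>L * norm (B (F' ?w (S k) - S k))"
    using norm_\<Lambda> by simp
  also have "\<dots> \<le> K\<^sub>L * (norm B * norm (F' ?w (S k) - S k))"
    by (intro mult_left_mono norm_blinfun nonneg)
  also have "\<dots> \<le> K\<^sub>L * (norm B * (K\<^sub>2 * norm ?w * norm (S k)))"
    by (intro mult_left_mono F'_increment wT ws S_T nonneg norm_ge_zero)
  also have "\<dots> \<le> K\<^sub>L * (norm B * (K\<^sub>2 * (\<Delta>\<^sub>s + K\<^sub>P * norm B * r) * (K\<^sub>P * norm B * norm k)))"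
    using \<Delta>\<^sub>s_pos
    by (intro mult_left_mono mult_mono norm_S w nonneg norm_ge_zero mult_nonneg_nonneg add_nonneg_nonneg) auto
  also have "\<dots> = K\<^sub>L * norm B * K\<^sub>2 * (K\<^sub>P * norm B) * (\<Delta>\<^sub>s + K\<^sub>P * norm B * r) * norm k" by (simp add: mult_ac)
  also have "\<dots> \<le> 1/2 * norm k" by (intro mult_right_mono radius_bounds(4) norm_ge_zero)
  finally show "norm (k - \<Lambda> (B (F' ?w (S k)))) \<le> 1/2 * norm k" .
next
  fix v :: 'e assume v: "norm v < \<Delta>\<^sub>s"
  note nonneg = constants_pos[THEN less_imp_le] K_pos[THEN less_imp_le]
  have Qv: "norm (Q v) \<le> \<sigma>" using Q(2)[of v] v radius_bounds(2) constants_pos by linarith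
  have "B (F (Q v)) - c = B (F (Q v) - F 0)" by (simp add: F_def R_0 y blinfun.zero_right blinfun.diff_right)
  then have "norm (\<Lambda> (B (F (Q v)) - c)) \<le> K\<^sub>L * norm (B (F (Q v) - F 0))" using norm_\<Lambda> by simp
  also have "\<dots> \<le> K\<^sub>L * (norm B * norm (F (Q v) - F 0))" by (intro mult_left_mono norm_blinfun nonneg)
  also have "\<dots> \<le> K\<^sub>L * (norm B * (K\<^sub>1 * norm (Q v)))"
    by (intro mult_left_mono F_increment Q_T Qv nonneg norm_ge_zero)
  also have "\<dots> \<le> K\<^sub>L * (norm B * (K\<^sub>1 * \<Delta>\<^sub>s))"
    using Q(2)[of v] v by (intro mult_left_mono nonneg norm_ge_zero) auto
  also have "\<dots> \<le> r / 2" using radius_bounds(3) by (simp add: mult_ac)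
  finally show "norm (\<Lambda> (B (F (Q v)) - c)) \<le> r / 2" .
qed

lemma corrected_retraction_eq:
  assumes v: "v \<in> W"
  shows "corrected_retraction B c P R r y v = \<R> v"
proof -
  have T: "P y (v - S d) = v - S d" for d
    using subspace_diff[OF subspace_T W_T[OF v] S_T] by (rule P_id)
  have "correction B c P R r y v = \<delta> v"
    unfolding correction_def \<delta>_def using v T by (simp add: F_def S_apply Q(3))
  then show ?thesis using v T by (simp add: corrected_retraction_def \<R>_def u_def F_def S_apply Q(3))
qed

lemma \<R>_in: "norm v < \<Delta>\<^sub>s \<Longrightarrow> \<R> v \<in> constrained M B c"
  using \<R>_constraint R_M[OF P_in_T] by (simp add: constrained_def \<R>_def F_def)

lemma \<R>_at_0: "\<R> 0 = y" by (simp add: \<R>_0 F_def R_0 blinfun.zero_right)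

lemma \<R>_curve:
  assumes v: "v \<in> W" shows "C1_curve_at (constrained M B c) y v (\<lambda>t. \<R> (t *\<^sub>R v))"
proof -
  \<comment> \<open>the summand \<open>1\<close> avoids a division by zero for \<open>v = 0\<close>\<close>
  define \<epsilon> where "\<epsilon> = \<Delta>\<^sub>s / (norm v + 1)"
  have pos: "norm v + 1 > 0" by (simp add: add_nonneg_pos)
  have small: "norm (t *\<^sub>R v) < \<Delta>\<^sub>s" if t: "t \<in> {-\<epsilon><..<\<epsilon>}" for t
  proof -
    have "\<bar>t\<bar> < \<Delta>\<^sub>s / (norm v + 1)" using t by (auto simp: \<epsilon>_def)
    then have "\<bar>t\<bar> * (norm v + 1) < \<Delta>\<^sub>s" using pos by (simp add: field_simps)
    then show ?thesis by (simp add: algebra_simps)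
  qed
  have line: "((\<lambda>t. t *\<^sub>R v) has_derivative (\<lambda>s. s *\<^sub>R v)) (at t)" for t
    by (auto intro!: derivative_eq_intros)
  have "isCont (\<lambda>t. \<R>' (t *\<^sub>R v) v) t" if t: "t \<in> {-\<epsilon><..<\<epsilon>}" for t
  proof -
    have "isCont \<R>' (t *\<^sub>R v)" using small[OF t] by (metis \<R>'_has_derivative has_derivative_continuous)
    then have "isCont (\<lambda>t. \<R>' (t *\<^sub>R v)) t"
      by (rule isCont_o2[where f = "\<lambda>t. t *\<^sub>R v", rotated]) (intro continuous_intros)
    then show ?thesis by (intro continuous_intros)
  qed
  then have cont: "continuous_on {-\<epsilon><..<\<epsilon>} (\<lambda>t. \<R>' (t *\<^sub>R v) v)"
    by (simp add: continuous_at_imp_continuous_on)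
  have curve: "\<R> (t *\<^sub>R v) \<in> constrained M B c \<and>
      ((\<lambda>t. \<R> (t *\<^sub>R v)) has_vector_derivative \<R>' (t *\<^sub>R v) v) (at t)" if t: "t \<in> {-\<epsilon><..<\<epsilon>}" for t
    using \<R>_in[OF small[OF t]] has_derivative_compose[OF line, OF \<R>_has_derivative[OF small[OF t]]]
    by (simp add: has_vector_derivative_def blinfun.scaleR_right)
  have pos_\<epsilon>: "\<epsilon> > 0" using pos \<Delta>\<^sub>s_pos by (simp add: \<epsilon>_def)
  have at_0: "\<R> (0 *\<^sub>R v) = y" "\<R>' (0 *\<^sub>R v) v = v" using v by (simp_all add: \<R>_at_0 \<R>'_0 Q(3))
  show ?thesis unfolding C1_curve_at_def
    by (intro exI[of _ \<epsilon>] exI[of _ "\<lambda>t. \<R>' (t *\<^sub>R v) v"] conjI ballI)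
      (use curve pos_\<epsilon> at_0 cont in blast)+
qed

text \<open>Curves in the constrained manifold have velocities in the kernel of \<open>B\<close>; conversely, the corrected
  retraction provides a curve for every vector of \<open>W\<close>.\<close>

lemma tangent_space_constrained: "tangent_space (constrained M B c) y = W"
proof (intro equalityI subsetI)
  fix v assume "v \<in> tangent_space (constrained M B c) y"
  then obtain \<gamma> where \<gamma>: "C1_curve_at (constrained M B c) y v \<gamma>" by (auto simp: tangent_space_def)
  then obtain \<epsilon> \<gamma>' where e: "\<epsilon> > 0" "\<forall>t\<in>{-\<epsilon><..<\<epsilon>}. \<gamma> t \<in> constrained M B c \<and> (\<gamma> has_vector_derivative \<gamma>' t) (at t)"
    "continuous_on {-\<epsilon><..<\<epsilon>} \<gamma>'" "\<gamma> 0 = y" "\<gamma>' 0 = v"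
    unfolding C1_curve_at_def by blast
  then have "C1_curve_at M y v \<gamma>" unfolding C1_curve_at_def constrained_def by blast
  then have vT: "v \<in> T" by (auto simp: tangent_space_def)
  have "(\<gamma> has_vector_derivative v) (at 0)" using e by force
  from bounded_linear.has_vector_derivative[OF blinfun.bounded_linear_right this]
  have 1: "((\<lambda>t. B (\<gamma> t)) has_vector_derivative B v) (at 0)" .
  have "((\<lambda>t. B (\<gamma> t)) has_vector_derivative 0) (at 0)"
    by (rule has_vector_derivative_transform_within_open[where f = "\<lambda>_. c" and S = "{-\<epsilon><..<\<epsilon>}"])
      (use e in \<open>auto simp: constrained_def\<close>)
  from vector_derivative_unique_at[OF 1 this] vT show "v \<in> W" by (simp add: W_def)
next
  fix v assume "v \<in> W"
  from \<R>_curve[OF this] show "v \<in> tangent_space (constrained M B c) y"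
    by (auto simp: tangent_space_def)
qed

text \<open>The chain rule along curves identifies the candidate; it is the only one because every vector of \<open>W\<close> is
  the velocity of a curve.\<close>

lemma riem_grad_constrained:
  assumes J: "GDERIV J y :> g"
  shows "riem_grad (constrained M B c) J y = Q g"
  unfolding riem_grad_def tangent_space_constrained
proof (rule the_equality)
  have d: "((\<lambda>t. J (\<gamma> t)) has_real_derivative Q g \<bullet> v) (at 0)"
    if \<gamma>: "C1_curve_at (constrained M B c) y v \<gamma>" for v \<gamma>
  proof -
    have v: "v \<in> W" using \<gamma> tangent_space_constrained by (auto simp: tangent_space_def)
    obtain \<epsilon> \<gamma>' where e: "\<epsilon> > 0" "\<forall>t\<in>{-\<epsilon><..<\<epsilon>}. (\<gamma> has_vector_derivative \<gamma>' t) (at t)"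
      "\<gamma> 0 = y" "\<gamma>' 0 = v"
      using \<gamma> unfolding C1_curve_at_def by blast
    then have "(\<gamma> has_derivative (\<lambda>s. s *\<^sub>R v)) (at 0)" by (force simp: has_vector_derivative_def)
    from has_derivative_compose[OF this, of J "\<lambda>h. h \<bullet> g"] J e(3)
    have "((\<lambda>t. J (\<gamma> t)) has_derivative (\<lambda>s. (s *\<^sub>R v) \<bullet> g)) (at 0)" by (simp add: gderiv_def)
    moreover have "(s *\<^sub>R v) \<bullet> g = (Q g \<bullet> v) * s" for s using Q(4)[OF v, of g] by (simp add: inner_commute)
    ultimately show ?thesis
      unfolding has_field_derivative_def by (rule has_derivative_eq_rhs[OF _ ext])
  qed
  then show "Q g \<in> W \<and> (\<forall>v \<gamma>. C1_curve_at (constrained M B c) y v \<gamma> \<longrightarrow>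
      ((\<lambda>t. J (\<gamma> t)) has_real_derivative Q g \<bullet> v) (at 0))" using Q(1) by blast
  fix g' assume g': "g' \<in> W \<and> (\<forall>v \<gamma>. C1_curve_at (constrained M B c) y v \<gamma> \<longrightarrow>
      ((\<lambda>t. J (\<gamma> t)) has_real_derivative g' \<bullet> v) (at 0))"
  have "g' \<bullet> v = Q g \<bullet> v" if "v \<in> W" for v
    using DERIV_unique[of _ "g' \<bullet> v" 0 "Q g \<bullet> v"] \<R>_curve[OF that] g' d by blast
  then have "(g' - Q g) \<bullet> (g' - Q g) = 0"
    using g' Q(1)[of g] subspace_W by (simp add: subspace_diff inner_diff_left)
  then show "g' = Q g" by simp
qed

text \<open>\<open>JB\<close> is the pullback of the objective to the tangent space. On \<open>W\<close> it agrees with \<open>J \<circ> \<R>\<close>, which is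
  differentiable in a ball of the ambient space.\<close>

context
  fixes J :: "'e \<Rightarrow> real" and gradJ :: "'e \<Rightarrow> 'e" and H :: "'e \<Rightarrow>\<^sub>L 'e" and JB :: "'e \<Rightarrow> real"
  assumes J: "\<And>z. GDERIV J z :> gradJ z"
    and gradJ: "(gradJ has_derivative H) (at y)"
    and JB: "\<And>v. JB v = J (corrected_retraction B c P R r y v)"
begin

definition "dJ v = blinfun_inner_right (gradJ (\<R> v)) o\<^sub>L \<R>' v"

lemma J\<R>_has_derivative:
  assumes "norm v < \<Delta>\<^sub>s" shows "((\<lambda>v. J (\<R> v)) has_derivative dJ v) (at v)"
proof -
  have "(J has_derivative (\<lambda>h. h \<bullet> gradJ (\<R> v))) (at (\<R> v))" using J[of "\<R> v"] by (simp add: gderiv_def)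
  from has_derivative_compose[OF \<R>_has_derivative[OF assms], OF this]
  show ?thesis by (simp add: dJ_def inner_commute blinfun_compose.rep_eq o_def)
qed

lemma pullback_radial_derivative:
  assumes \<xi>: "\<xi> \<in> W" "norm \<xi> = 1" and t: "0 \<le> t" "t < \<Delta>\<^sub>s"
  shows "((\<lambda>s. JB (s *\<^sub>R \<xi>)) has_real_derivative dJ (t *\<^sub>R \<xi>) \<xi>) (at t)" and "dJ 0 \<xi> = Q (gradJ y) \<bullet> \<xi>"
proof -
  have line: "((\<lambda>t. t *\<^sub>R \<xi>) has_derivative (\<lambda>s. s *\<^sub>R \<xi>)) (at t)" by (auto intro!: derivative_eq_intros)
  have eq: "JB (s *\<^sub>R \<xi>) = J (\<R> (s *\<^sub>R \<xi>))" for s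
    using corrected_retraction_eq[OF subspace_scale[OF subspace_W \<xi>(1)]] by (simp add: JB)
  have "norm (t *\<^sub>R \<xi>) < \<Delta>\<^sub>s" using \<xi>(2) t by simp
  from has_derivative_compose[OF line, OF J\<R>_has_derivative[OF this]]
  show "((\<lambda>s. JB (s *\<^sub>R \<xi>)) has_real_derivative dJ (t *\<^sub>R \<xi>) \<xi>) (at t)"
    unfolding eq has_field_derivative_def
    by (rule has_derivative_eq_rhs) (simp add: blinfun.scaleR_right fun_eq_iff)
  show "dJ 0 \<xi> = Q (gradJ y) \<bullet> \<xi>" using Q(3,4)[OF \<xi>(1)] by (simp add: dJ_def \<R>_at_0 \<R>'_0)
qed

text \<open>By the mean value theorem along the ray through \<open>p\<close>, the increment of \<open>JB\<close> is \<open>norm p\<close> times the radial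
  derivative at an intermediate point, which differs from that at \<open>0\<close> by at most \<open>\<beta> * norm p\<close>.\<close>

lemma pullback_linearization_error:
  assumes lip: "\<And>\<xi> t. \<lbrakk>\<xi> \<in> W; norm \<xi> = 1; 0 \<le> t; t \<le> D\<rbrakk> \<Longrightarrow>
      \<bar>deriv (\<lambda>s. JB (s *\<^sub>R \<xi>)) t - deriv (\<lambda>s. JB (s *\<^sub>R \<xi>)) 0\<bar> \<le> \<beta> * t"
    and D: "D < \<Delta>\<^sub>s" and \<beta>: "0 \<le> \<beta>" and p: "p \<in> W" "norm p \<le> D"
  shows "\<bar>JB p - JB 0 - Q (gradJ y) \<bullet> p\<bar> \<le> \<beta> * (norm p)\<^sup>2"
proof (cases "p = 0")
  case False
  define \<xi> where "\<xi> = p /\<^sub>R norm p"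
  have \<xi>: "\<xi> \<in> W" "norm \<xi> = 1" and p_eq: "p = norm p *\<^sub>R \<xi>"
    using False p(1) subspace_W by (auto simp: \<xi>_def subspace_scale)
  have der: "((\<lambda>s. JB (s *\<^sub>R \<xi>)) has_real_derivative dJ (t *\<^sub>R \<xi>) \<xi>) (at t)" if "0 \<le> t" "t \<le> norm p" for t
    using that p(2) D by (intro pullback_radial_derivative \<xi>) auto
  obtain z where z: "0 < z" "z < norm p"
    "JB (norm p *\<^sub>R \<xi>) - JB (0 *\<^sub>R \<xi>) = (norm p - 0) * dJ (z *\<^sub>R \<xi>) \<xi>"
    using MVT2[of 0 "norm p" "\<lambda>s. JB (s *\<^sub>R \<xi>)" "\<lambda>t. dJ (t *\<^sub>R \<xi>) \<xi>"] der False by auto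
  have "\<bar>dJ (z *\<^sub>R \<xi>) \<xi> - dJ 0 \<xi>\<bar> \<le> \<beta> * z"
    using lip[OF \<xi>, of z] DERIV_imp_deriv[OF der, of z] DERIV_imp_deriv[OF der, of 0] z p(2) by simp
  also have "\<dots> \<le> \<beta> * norm p" using z \<beta> by (intro mult_left_mono) auto
  finally have 1: "\<bar>dJ (z *\<^sub>R \<xi>) \<xi> - dJ 0 \<xi>\<bar> \<le> \<beta> * norm p" .
  have "dJ 0 \<xi> = Q (gradJ y) \<bullet> \<xi>" using pullback_radial_derivative(2)[OF \<xi>, of 0] \<Delta>\<^sub>s_pos by simp
  then have "Q (gradJ y) \<bullet> p = norm p * dJ 0 \<xi>" by (subst p_eq) (simp add: inner_scaleR_right)
  then have "JB p - JB 0 - Q (gradJ y) \<bullet> p = norm p * (dJ (z *\<^sub>R \<xi>) \<xi> - dJ 0 \<xi>)"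
    using z(3) p_eq by (simp add: algebra_simps)
  then have "\<bar>JB p - JB 0 - Q (gradJ y) \<bullet> p\<bar> = norm p * \<bar>dJ (z *\<^sub>R \<xi>) \<xi> - dJ 0 \<xi>\<bar>"
    by (simp add: abs_mult)
  also have "\<dots> \<le> norm p * (\<beta> * norm p)" using 1 by (intro mult_left_mono) auto
  finally show ?thesis by (simp add: power2_eq_square mult_ac)
qed simp

text \<open>
  For \<open>\<xi>, \<eta>\<close> in \<open>W\<close> the second derivative of \<open>J \<circ> \<R>\<close> at \<open>0\<close> is the sum of \<open>H \<xi> \<bullet> \<eta>\<close> and the product of \<open>gradJ y\<close>
  with the second derivative of \<open>\<R>\<close>. Evaluating it at \<open>\<eta> = Hess \<xi>\<close> gives the square of the norm to be
  bounded. The bound depends on \<open>y\<close> only through the norms of \<open>H\<close> and \<open>gradJ y\<close>.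
\<close>

lemma pullback_hessian_bound:
  assumes \<xi>: "\<xi> \<in> W"
  shows "norm (hess_on W JB 0 \<xi>)
    \<le> (norm (H) + norm (gradJ y) * ((1 + K\<^sub>P * norm B * K\<^sub>L * norm B) * K\<^sub>2)) * norm \<xi>"
proof -
  obtain G where G: "(\<R>' has_derivative G) (at 0)"
    "\<forall>h k. G h k = F'' 0 (Q h) (Q k) - S (\<Lambda> (B (F'' 0 (Q h) (Q k))))"
    using \<R>'_has_derivative[of 0] \<Delta>\<^sub>s_pos by auto
  have "((\<lambda>v. gradJ (\<R> v)) has_derivative (\<lambda>h. H (Q h))) (at 0)"
    using has_derivative_compose[OF \<R>_has_derivative, of 0 gradJ "H"] gradJ \<Delta>\<^sub>s_pos
    by (simp add: \<R>_at_0 \<R>'_0)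
  then have "((\<lambda>v. blinfun_inner_right (gradJ (\<R> v))) has_derivative (\<lambda>h. blinfun_inner_right (H (Q h)))) (at 0)"
    by (rule bounded_linear.has_derivative[OF bounded_linear_blinfun_inner_right])
  from bounded_bilinear.FDERIV[OF bounded_bilinear_blinfun_compose this G(1)]
  have dJ: "(dJ has_derivative (\<lambda>h. (blinfun_inner_right (gradJ y) o\<^sub>L G h) + (blinfun_inner_right (H (Q h)) o\<^sub>L Q))) (at 0)"
    by (simp add: dJ_def[abs_def] \<R>_at_0 \<R>'_0)
  have JB_eq: "JB v = J (\<R> v)" if "v \<in> W" for v
    using corrected_retraction_eq[OF that] by (simp add: JB)
  let ?H = "hess_on W JB 0 \<xi>"
  have HW: "?H \<in> W"
    by (rule hess_on_of_extension(1)[OF subspace_W closed_W \<Delta>\<^sub>s_pos _ dJ _ \<xi>])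
      (simp_all add: J\<R>_has_derivative JB_eq)
  have HH: "?H \<bullet> ?H
      = ((blinfun_inner_right (gradJ y) o\<^sub>L G \<xi>) + (blinfun_inner_right (H (Q \<xi>)) o\<^sub>L Q)) ?H"
    by (rule hess_on_of_extension(2)[OF subspace_W closed_W \<Delta>\<^sub>s_pos _ dJ _ \<xi> HW])
      (simp_all add: J\<R>_has_derivative JB_eq)
  let ?z = "F'' 0 \<xi> ?H"
  note nonneg = constants_pos[THEN less_imp_le] K_pos[THEN less_imp_le]
  have "norm ?z \<le> K\<^sub>2 * norm \<xi> * norm ?H"
    using HW \<xi> subspace_T nonneg by (intro F''_bound) (auto simp: W_def subspace_0)
  moreover have "norm (?z - S (\<Lambda> (B ?z))) \<le> (1 + K\<^sub>P * norm B * K\<^sub>L * norm B) * norm ?z"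
  proof -
    have "norm (S (\<Lambda> (B ?z))) \<le> K\<^sub>P * norm B * norm (\<Lambda> (B ?z))" by (rule norm_S)
    also have "\<dots> \<le> K\<^sub>P * norm B * (K\<^sub>L * norm (B ?z))"
      by (intro mult_left_mono norm_\<Lambda> mult_nonneg_nonneg nonneg)
    also have "\<dots> \<le> K\<^sub>P * norm B * (K\<^sub>L * (norm B * norm ?z))"
      by (intro mult_left_mono norm_blinfun mult_nonneg_nonneg nonneg)
    finally show ?thesis using norm_triangle_ineq4[of ?z "S (\<Lambda> (B ?z))"] by (simp add: algebra_simps)
  qed
  ultimately have z: "norm (?z - S (\<Lambda> (B ?z))) \<le> (1 + K\<^sub>P * norm B * K\<^sub>L * norm B) * (K\<^sub>2 * norm \<xi> * norm ?H)"
    by (smt (verit) mult_left_mono mult_nonneg_nonneg nonneg)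
  have "norm ?H * norm ?H = ?H \<bullet> ?H" by (simp add: dot_square_norm power2_eq_square)
  also have "\<dots> = gradJ y \<bullet> (?z - S (\<Lambda> (B ?z))) + H \<xi> \<bullet> ?H"
    unfolding HH using G(2) Q(3) \<xi> HW by (simp add: blinfun.add_left)
  also have "\<dots> \<le> norm (gradJ y) * norm (?z - S (\<Lambda> (B ?z))) + norm (H \<xi>) * norm ?H"
    by (intro add_mono norm_cauchy_schwarz)
  also have "\<dots> \<le> norm (gradJ y) * ((1 + K\<^sub>P * norm B * K\<^sub>L * norm B) * (K\<^sub>2 * norm \<xi> * norm ?H))
      + norm (H) * norm \<xi> * norm ?H"
    by (intro add_mono mult_left_mono mult_right_mono z norm_blinfun norm_ge_zero)
  also have "\<dots> = ((norm (H) + norm (gradJ y) * ((1 + K\<^sub>P * norm B * K\<^sub>L * norm B) * K\<^sub>2)) * norm \<xi>) * norm ?H"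
    by (simp add: algebra_simps)
  finally show ?thesis
    using nonneg by (cases "norm ?H = 0") (auto simp: mult_le_cancel_right)
qed

end

end

section \<open>Convergence of the Riemannian trust-region method\<close>

theorem theorem8p1:
  fixes M :: "'e::{real_inner,banach} set"
    and B :: "'e \<Rightarrow>\<^sub>L 'y::{real_inner,banach}" and c :: 'y
    and P :: "'e \<Rightarrow> 'e \<Rightarrow>\<^sub>L 'e"
    and R :: "'e \<Rightarrow> 'e \<Rightarrow> 'e"
    and DR :: "'e \<Rightarrow> 'e \<Rightarrow> 'e \<Rightarrow>\<^sub>L 'e"
    and D2R :: "'e \<Rightarrow> 'e \<Rightarrow> 'e \<Rightarrow>\<^sub>L 'e \<Rightarrow>\<^sub>L 'e"
    and J :: "'e \<Rightarrow> real" and gradJ :: "'e \<Rightarrow> 'e" and HessJ :: "'e \<Rightarrow> 'e \<Rightarrow>\<^sub>L 'e"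
    and MB X :: "'e set" and TB :: "'e \<Rightarrow> 'e set"
    and K\<^sub>P K\<^sub>L \<sigma> K\<^sub>1 K\<^sub>2 r \<Delta>\<^sub>s \<Delta>\<^sub>R\<^sub>L \<beta>\<^sub>R\<^sub>L :: real
    and RB :: "'e \<Rightarrow> 'e \<Rightarrow> 'e" and JB :: "'e \<Rightarrow> 'e \<Rightarrow> real"
    and gradJB :: "'e \<Rightarrow> 'e" and HessJB :: "'e \<Rightarrow> 'e \<Rightarrow> 'e"
    and \<Delta>bar rtil c\<^sub>1 :: real
    and x p xplus :: "nat \<Rightarrow> 'e" and \<Delta> \<rho> :: "nat \<Rightarrow> real" and m :: "nat \<Rightarrow> 'e \<Rightarrow> real"
  assumes Y_nontrivial: "(UNIV :: 'y set) \<noteq> {0}"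
    \<comment> \<open>constraint manifold, projections, retractions\<close>
    and M: "C2_submanifold M"
    and B_surj: "surj (blinfun_apply B)"
    and MB: "MB = constrained M B c"
    and MB_ne: "MB \<noteq> {}"
    and P_onto: "\<And>y. y \<in> M \<Longrightarrow> range (blinfun_apply (P y)) = tangent_space M y"
    and P_id: "\<And>y v. \<lbrakk>y \<in> M; v \<in> tangent_space M y\<rbrakk> \<Longrightarrow> blinfun_apply (P y) v = v"
    and R_M: "\<And>y u. \<lbrakk>y \<in> M; u \<in> tangent_space M y\<rbrakk> \<Longrightarrow> R y u \<in> M"
    and R_C2: "\<And>y. y \<in> M \<Longrightarrow> C2_on (tangent_space M y) (R y) (DR y) (D2R y)"
    and R_0: "\<And>y. y \<in> M \<Longrightarrow> R y 0 = y"
    and DR_0: "\<And>y v. \<lbrakk>y \<in> M; v \<in> tangent_space M y\<rbrakk> \<Longrightarrow> blinfun_apply (DR y 0) v = v"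
    and D2R_0: "\<And>S. \<lbrakk>S \<subseteq> M; bounded S\<rbrakk> \<Longrightarrow>
          \<exists>K. \<forall>y\<in>S. onorm2_on (tangent_space M y) (\<lambda>v w. blinfun_apply (blinfun_apply (D2R y 0) v) w) \<le> K"
    \<comment> \<open>standing assumptions\<close>
    and A1: "\<And>S. \<lbrakk>S \<subseteq> MB; bounded S\<rbrakk> \<Longrightarrow>
          \<exists>C>0. \<forall>y\<in>S. \<forall>d. schur_op B P y d \<bullet> d \<ge> C * (norm d)\<^sup>2"
    and A2_cont: "continuous_on M P"
    and A2_bdd: "\<And>S. \<lbrakk>S \<subseteq> M; bounded S\<rbrakk> \<Longrightarrow> bounded (P ` S)"
    and A3: "\<And>S. \<lbrakk>S \<subseteq> M; bounded S\<rbrakk> \<Longrightarrow>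
          \<exists>s>0. \<exists>k\<^sub>1>0. \<exists>k\<^sub>2>0. \<forall>y\<in>S. \<forall>u\<in>tangent_space M y. norm u \<le> s \<longrightarrow>
            onorm_on (tangent_space M y) (blinfun_apply (DR y u)) \<le> k\<^sub>1 \<and>
            onorm2_on (tangent_space M y) (\<lambda>v w. blinfun_apply (blinfun_apply (D2R y u) v) w) \<le> k\<^sub>2"
    \<comment> \<open>objective\<close>
    and J_grad: "\<And>y. GDERIV J y :> gradJ y"
    and J_Hess: "\<And>y. (gradJ has_derivative blinfun_apply (HessJ y)) (at y)"
    and J_C2: "continuous_on UNIV HessJ"
    and J_below: "bdd_below (range J)"
    and J_coercive: "\<And>a. bounded {y. J y \<le> a}"
    and gradJ_bdd: "\<And>S. bounded S \<Longrightarrow> bounded (gradJ ` S)"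
    and HessJ_bdd: "\<And>S. bounded S \<Longrightarrow> bounded (HessJ ` S)"
    \<comment> \<open>initial sublevel set and its constants\<close>
    and x0: "x 0 \<in> MB"
    and X: "X = {y\<in>MB. J y \<le> J (x 0)}"
    and K\<^sub>P: "\<And>y. y \<in> X \<Longrightarrow> norm (P y) \<le> K\<^sub>P"
    and K\<^sub>L: "\<And>y. y \<in> X \<Longrightarrow> onorm (inv (schur_op B P y)) \<le> K\<^sub>L"
    and A3_pos: "\<sigma> > 0" "K\<^sub>1 > 0" "K\<^sub>2 > 0"
    and A3_X: "\<And>y u. \<lbrakk>y \<in> X; u \<in> tangent_space M y; norm u \<le> \<sigma>\<rbrakk> \<Longrightarrow>
            onorm_on (tangent_space M y) (blinfun_apply (DR y u)) \<le> K\<^sub>1 \<and>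
            onorm2_on (tangent_space M y) (\<lambda>v w. blinfun_apply (blinfun_apply (D2R y u) v) w) \<le> K\<^sub>2"
    and r: "r = min (\<sigma> / (2 * K\<^sub>P * norm B)) (1 / (4 * K\<^sub>2 * K\<^sub>L * K\<^sub>P\<^sup>2 * norm B ^ 3))"
    and \<Delta>\<^sub>s: "\<Delta>\<^sub>s = min (\<sigma> / 2) (min (1 / (4 * K\<^sub>2 * K\<^sub>L * K\<^sub>P * (norm B)\<^sup>2)) (r / (2 * K\<^sub>1 * K\<^sub>L * norm B)))"
    \<comment> \<open>Riemannian quantities on the constrained manifold\<close>
    and TB: "\<And>y. TB y = tangent_space MB y"
    and RB: "\<And>y v. RB y v = corrected_retraction B c P R r y v"
    and JB: "\<And>y v. JB y v = J (RB y v)"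
    and gradJB: "\<And>y. gradJB y = riem_grad MB J y"
    and HessJB: "\<And>y. HessJB y = hess_on (TB y) (JB y) 0"
    and \<Delta>\<^sub>R\<^sub>L: "0 < \<Delta>\<^sub>R\<^sub>L" "\<Delta>\<^sub>R\<^sub>L < \<Delta>\<^sub>s"
    and \<beta>\<^sub>R\<^sub>L: "\<beta>\<^sub>R\<^sub>L > 0"
    and radially_Lipschitz: "\<And>y \<xi> t. \<lbrakk>y \<in> X; \<xi> \<in> TB y; norm \<xi> = 1; 0 \<le> t; t \<le> \<Delta>\<^sub>R\<^sub>L\<rbrakk> \<Longrightarrow>
          \<bar>deriv (\<lambda>s. JB y (s *\<^sub>R \<xi>)) t - deriv (\<lambda>s. JB y (s *\<^sub>R \<xi>)) 0\<bar> \<le> \<beta>\<^sub>R\<^sub>L * t"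
    \<comment> \<open>trust-region method\<close>
    and \<Delta>bar: "0 < \<Delta>bar" "\<Delta>bar \<le> \<Delta>\<^sub>R\<^sub>L"
    and \<Delta>_0: "0 < \<Delta> 0" "\<Delta> 0 \<le> \<Delta>bar"
    and rtil: "0 \<le> rtil" "rtil < 1/4"
    and m: "\<And>k q. m k q = JB (x k) 0 + gradJB (x k) \<bullet> q + 1/2 * (HessJB (x k) q \<bullet> q)"
    and p_tangent: "\<And>k. p k \<in> TB (x k)"
    and p_radius: "\<And>k. norm (p k) \<le> \<Delta> k"
    and xplus: "\<And>k. xplus k = RB (x k) (p k)"
    and m_ne: "\<And>k. m k 0 - m k (p k) \<noteq> 0"
    and \<rho>: "\<And>k. \<rho> k = (J (x k) - J (xplus k)) / (m k 0 - m k (p k))"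
    and \<Delta>_Suc: "\<And>k. \<Delta> (Suc k) =
          (if \<rho> k < 1/4 then 1/4 * \<Delta> k
           else if \<rho> k > 3/4 \<and> norm (p k) = \<Delta> k then min (2 * \<Delta> k) \<Delta>bar
           else \<Delta> k)"
    and x_Suc: "\<And>k. x (Suc k) = (if \<rho> k > rtil then xplus k else x k)"
    \<comment> \<open>Cauchy decrease; the quotient counts as infinite for a vanishing Hessian\<close>
    and c\<^sub>1: "c\<^sub>1 > 0"
    and Cauchy_decrease: "\<And>k. m k 0 - m k (p k) \<ge> c\<^sub>1 * norm (gradJB (x k)) *
          (if onorm_on (TB (x k)) (HessJB (x k)) = 0 then \<Delta> k
           else min (\<Delta> k) (norm (gradJB (x k)) / onorm_on (TB (x k)) (HessJB (x k))))"
  shows "liminf (\<lambda>k. ereal (norm (gradJB (x k)))) = 0"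
proof -
  have X_M: "X \<subseteq> M" "X \<subseteq> MB" by (auto simp: X MB constrained_def)
  have X_bdd: "bounded X" by (rule bounded_subset[OF J_coercive[of "J (x 0)"]]) (auto simp: X)
  \<comment> \<open>one coercivity constant for the whole sublevel set, so that it can be a locale parameter\<close>
  obtain C where C: "C > 0" "\<And>y d. y \<in> X \<Longrightarrow> schur_op B P y d \<bullet> d \<ge> C * (norm d)\<^sup>2"
    using A1[OF X_M(2) X_bdd] by blast
  have \<Delta>\<^sub>s_pos: "0 < \<Delta>\<^sub>s" using \<Delta>\<^sub>R\<^sub>L by simp
  have point: "constrained_point M B c P R DR D2R y C K\<^sub>P K\<^sub>L \<sigma> K\<^sub>1 K\<^sub>2 r \<Delta>\<^sub>s" if yX: "y \<in> X" for y
  proof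
    have yM: "y \<in> M" using yX X_M by blast
    show "y \<in> M" by fact
    show "B y = c" using yX by (simp add: X MB constrained_def)
    show "range (P y) = tangent_space M y" by (rule P_onto[OF yM])
    show "P y v = v" if "v \<in> tangent_space M y" for v by (rule P_id[OF yM that])
    show "R y v \<in> M" if "v \<in> tangent_space M y" for v by (rule R_M[OF yM that])
    show "C2_on (tangent_space M y) (R y) (DR y) (D2R y)" by (rule R_C2[OF yM])
    show "R y 0 = y" by (rule R_0[OF yM])
    show "DR y 0 v = v" if "v \<in> tangent_space M y" for v by (rule DR_0[OF yM that])
    show "C * (norm d)\<^sup>2 \<le> schur_op B P y d \<bullet> d" for d by (rule C(2)[OF yX])
    show "norm (P y) \<le> K\<^sub>P" by (rule K\<^sub>P[OF yX])
    show "onorm (inv (schur_op B P y)) \<le> K\<^sub>L" by (rule K\<^sub>L[OF yX])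
    show "onorm_on (tangent_space M y) (DR y w) \<le> K\<^sub>1"
      "onorm2_on (tangent_space M y) (\<lambda>v z. D2R y w v z) \<le> K\<^sub>2"
      if "w \<in> tangent_space M y" "norm w \<le> \<sigma>" for w
      using A3_X[OF yX that] by blast+
    show "r = min (\<sigma> / (2 * K\<^sub>P * norm B)) (1 / (4 * K\<^sub>2 * K\<^sub>L * K\<^sub>P\<^sup>2 * norm B ^ 3))" by (rule r)
    show "\<Delta>\<^sub>s = min (\<sigma> / 2) (min (1 / (4 * K\<^sub>2 * K\<^sub>L * K\<^sub>P * (norm B)\<^sup>2)) (r / (2 * K\<^sub>1 * K\<^sub>L * norm B)))"
      by (rule \<Delta>\<^sub>s)
  qed (fact C(1) A3_pos \<Delta>\<^sub>s_pos)+
  obtain bg where bg: "\<And>y. y \<in> X \<Longrightarrow> norm (gradJ y) \<le> bg"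
    using gradJ_bdd[OF X_bdd] unfolding bounded_iff by blast
  obtain bh where bh: "\<And>y. y \<in> X \<Longrightarrow> norm (HessJ y) \<le> bh"
    using HessJ_bdd[OF X_bdd] unfolding bounded_iff by blast
  \<comment> \<open>bounds the Hessians of all pullbacks at points of the sublevel set\<close>
  define Kh where "Kh = bh + bg * ((1 + K\<^sub>P * norm B * K\<^sub>L * norm B) * K\<^sub>2)"
  have JB_fun: "JB y = (\<lambda>v. J (corrected_retraction B c P R r y v))" for y by (auto simp: JB RB)
  have TB_W: "TB y = constrained_point.W M B y" if "y \<in> X" for y
    using constrained_point.tangent_space_constrained[OF point[OF that]] by (simp add: TB MB)
  have hess: "norm (HessJB y \<xi>) \<le> Kh * norm \<xi>" if yX: "y \<in> X" and \<xi>: "\<xi> \<in> TB y" for y \<xi>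
  proof -
    interpret constrained_point M B c P R DR D2R y C K\<^sub>P K\<^sub>L \<sigma> K\<^sub>1 K\<^sub>2 r \<Delta>\<^sub>s by (rule point[OF yX])
    have "norm (hess_on W (JB y) 0 \<xi>)
        \<le> (norm (HessJ y) + norm (gradJ y) * ((1 + K\<^sub>P * norm B * K\<^sub>L * norm B) * K\<^sub>2)) * norm \<xi>"
      using \<xi> TB_W[OF yX] by (intro pullback_hessian_bound[where J = J and gradJ = gradJ, OF J_grad J_Hess]) (simp_all add: JB_fun)
    also have "\<dots> \<le> Kh * norm \<xi>"
      unfolding Kh_def using bg[OF yX] bh[OF yX] constants_pos K_pos
      by (intro mult_right_mono add_mono) auto
    finally show ?thesis by (simp add: HessJB TB_W[OF yX])
  qed
  have h_bounds: "0 \<le> onorm_on (TB y) (HessJB y)" "onorm_on (TB y) (HessJB y) \<le> \<bar>Kh\<bar>" if yX: "y \<in> X" for y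
  proof -
    interpret constrained_point M B c P R DR D2R y C K\<^sub>P K\<^sub>L \<sigma> K\<^sub>1 K\<^sub>2 r \<Delta>\<^sub>s by (rule point[OF yX])
    have 0: "0 \<in> TB y" using subspace_0[OF subspace_W] TB_W[OF yX] by simp
    have le: "norm (HessJB y v) / norm v \<le> \<bar>Kh\<bar>" if "v \<in> TB y" for v
      using order_trans[OF hess[OF yX that] mult_right_mono[OF abs_ge_self[of Kh] norm_ge_zero[of v]]]
      by (cases "v = 0") (simp_all add: divide_le_eq)
    then show "onorm_on (TB y) (HessJB y) \<le> \<bar>Kh\<bar>"
      unfolding onorm_on_def using 0 by (intro cSUP_least) auto
    have "bdd_above ((\<lambda>v. norm (HessJB y v) / norm v) ` TB y)" using le by (rule bdd_aboveI2)
    from cSUP_upper[OF 0 this] show "0 \<le> onorm_on (TB y) (HessJB y)" by (simp add: onorm_on_def)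
  qed
  define pred where "pred k = m k 0 - m k (p k)" for k
  have \<Delta>: "0 < \<Delta> k \<and> \<Delta> k \<le> \<Delta>bar" for k
  proof (induction k)
    case (Suc k)
    then show ?case using \<Delta>bar(1) by (auto simp: \<Delta>_Suc)
  qed (use \<Delta>_0 in auto)
  have p_small: "norm (p k) \<le> \<Delta>\<^sub>R\<^sub>L" for k using p_radius[of k] \<Delta>[of k] \<Delta>bar(2) by linarith
  have pred_pos: "pred k > 0" if "x k \<in> X" for k
  proof -
    have "0 \<le> c\<^sub>1 * norm (gradJB (x k)) * (if onorm_on (TB (x k)) (HessJB (x k)) = 0 then \<Delta> k
           else min (\<Delta> k) (norm (gradJB (x k)) / onorm_on (TB (x k)) (HessJB (x k))))"
      using c\<^sub>1 \<Delta>[of k] h_bounds(1)[OF that] by auto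
    then show ?thesis using Cauchy_decrease[of k] m_ne[of k] unfolding pred_def by linarith
  qed
  have xplus_MB: "xplus k \<in> MB" if xX: "x k \<in> X" for k
  proof -
    interpret constrained_point M B c P R DR D2R "x k" C K\<^sub>P K\<^sub>L \<sigma> K\<^sub>1 K\<^sub>2 r \<Delta>\<^sub>s by (rule point[OF xX])
    have "p k \<in> W" using p_tangent[of k] TB_W[OF xX] by simp
    then show ?thesis using p_small[of k] \<Delta>\<^sub>R\<^sub>L by (simp add: xplus RB corrected_retraction_eq MB \<R>_in)
  qed
  \<comment> \<open>accepted steps satisfy the constraint and decrease the objective\<close>
  have xX: "x k \<in> X" for k
  proof (induction k)
    case (Suc k)
    show ?case
    proof (cases "\<rho> k > rtil")
      case True
      then have "0 < (J (x k) - J (xplus k)) / pred k" using rtil(1) by (simp add: \<rho> pred_def)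
      then have "J (xplus k) < J (x k)" using pred_pos[OF Suc] by (simp add: zero_less_divide_iff)
      then show ?thesis using True Suc xplus_MB[OF Suc] by (simp add: x_Suc X)
    qed (simp add: x_Suc Suc)
  qed (simp add: X x0)
  \<comment> \<open>the left-hand side combines the linearization error of the pullback with the quadratic term of the model\<close>
  have model: "\<bar>J (x k) - J (xplus k) - pred k\<bar> \<le> (\<beta>\<^sub>R\<^sub>L + \<bar>Kh\<bar> / 2) * (\<Delta> k)\<^sup>2" for k
  proof -
    interpret constrained_point M B c P R DR D2R "x k" C K\<^sub>P K\<^sub>L \<sigma> K\<^sub>1 K\<^sub>2 r \<Delta>\<^sub>s by (rule point[OF xX])
    have pW: "p k \<in> W" using p_tangent[of k] TB_W[OF xX] by simp
    have grad: "gradJB (x k) = Q (gradJ (x k))"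
      using riem_grad_constrained[OF J_grad] by (simp add: gradJB MB)
    have "\<bar>JB (x k) (p k) - JB (x k) 0 - gradJB (x k) \<bullet> p k\<bar> \<le> \<beta>\<^sub>R\<^sub>L * (norm (p k))\<^sup>2"
      unfolding grad
    proof (rule pullback_linearization_error[where J = J and gradJ = gradJ, OF J_grad J_Hess _ _ \<Delta>\<^sub>R\<^sub>L(2) _ pW p_small])
      show "JB (x k) v = J (corrected_retraction B c P R r (x k) v)" for v by (simp add: JB_fun)
      show "\<bar>deriv (\<lambda>s. JB (x k) (s *\<^sub>R \<xi>)) t - deriv (\<lambda>s. JB (x k) (s *\<^sub>R \<xi>)) 0\<bar> \<le> \<beta>\<^sub>R\<^sub>L * t"
        if "\<xi> \<in> W" "norm \<xi> = 1" "0 \<le> t" "t \<le> \<Delta>\<^sub>R\<^sub>L" for \<xi> t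
        using that TB_W[OF xX] by (intro radially_Lipschitz xX) auto
    qed (use \<beta>\<^sub>R\<^sub>L in simp)
    moreover have "JB (x k) 0 = J (x k)"
      using subspace_0[OF subspace_W] by (simp add: JB_fun corrected_retraction_eq \<R>_at_0)
    moreover have "JB (x k) (p k) = J (xplus k)" by (simp add: JB xplus)
    moreover have "pred k = - (gradJB (x k) \<bullet> p k) - 1/2 * (HessJB (x k) (p k) \<bullet> p k)"
      by (simp add: pred_def m)
    moreover have "\<bar>HessJB (x k) (p k) \<bullet> p k\<bar> \<le> \<bar>Kh\<bar> * (norm (p k))\<^sup>2"
    proof -
      have "\<bar>HessJB (x k) (p k) \<bullet> p k\<bar> \<le> norm (HessJB (x k) (p k)) * norm (p k)" by (rule Cauchy_Schwarz_ineq2)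
      also have "\<dots> \<le> \<bar>Kh\<bar> * norm (p k) * norm (p k)"
        by (intro mult_right_mono norm_ge_zero
            order_trans[OF hess[OF xX p_tangent] mult_right_mono[OF abs_ge_self norm_ge_zero]])
      finally show ?thesis by (simp add: power2_eq_square)
    qed
    ultimately have "\<bar>J (x k) - J (xplus k) - pred k\<bar> \<le> \<beta>\<^sub>R\<^sub>L * (norm (p k))\<^sup>2 + \<bar>Kh\<bar> * (norm (p k))\<^sup>2 / 2"
      by linarith
    also have "\<dots> = (\<beta>\<^sub>R\<^sub>L + \<bar>Kh\<bar> / 2) * (norm (p k))\<^sup>2" by (simp add: algebra_simps)
    also have "\<dots> \<le> (\<beta>\<^sub>R\<^sub>L + \<bar>Kh\<bar> / 2) * (\<Delta> k)\<^sup>2"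
      using p_radius[of k] \<beta>\<^sub>R\<^sub>L by (intro mult_left_mono power_mono) auto
    finally show ?thesis .
  qed
  obtain l where l: "\<And>z. J z \<ge> l" using J_below by (auto simp: bdd_below_def)
  show ?thesis
  proof (rule trust_region_liminf[where f = "\<lambda>k. J (x k)" and fp = "\<lambda>k. J (xplus k)" and pred = pred
        and h = "\<lambda>k. onorm_on (TB (x k)) (HessJB (x k))" and \<Delta> = \<Delta> and D = \<Delta>bar and C = "\<bar>Kh\<bar>"
        and \<rho> = \<rho> and full = "\<lambda>k. norm (p k) = \<Delta> k" and rtil = rtil and c = c\<^sub>1 and l = l
        and E = "\<beta>\<^sub>R\<^sub>L + \<bar>Kh\<bar> / 2"])
    show "pred k \<ge> c\<^sub>1 * norm (gradJB (x k)) * (if onorm_on (TB (x k)) (HessJB (x k)) = 0 then \<Delta> k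
        else min (\<Delta> k) (norm (gradJB (x k)) / onorm_on (TB (x k)) (HessJB (x k))))" for k
      unfolding pred_def by (rule Cauchy_decrease)
    show "\<rho> k = (J (x k) - J (xplus k)) / pred k" for k unfolding pred_def by (rule \<rho>)
  qed (use \<Delta> xX h_bounds pred_pos model \<Delta>_Suc x_Suc rtil c\<^sub>1 l in auto)
qed

end
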